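(* Let $n$ be a positive integer, let $0<\alpha<n$, set $\alpha^*=\frac{n+\alpha}{n-\alpha}$, and let $p\le\alpha^*$. If a positive solution $u$ of the integral equation $$u(x)=\int_{\mathbb{R}^n}\frac{1}{|x-y|^{n-\alpha}}\,u(y)^p\,dy$$ has only one singularity, at a point $x^o\in\mathbb{R}^n$, then $u$ is radially symmetric about $x^o$; that is, $u(x)=u(y)$ whenever $x,y\in\mathbb{R}^n\setminus\{x^o\}$ satisfy $|x-x^o|=|y-x^o|$.
   Context: $p$ is a real exponent. A positive solution is a positive measurable function $u$ for which the integral on the right-hand side is finite and equal to $u(x)$ at every non-singular point $x$. A point is a singularity of $u$ if $u$ is unbounded in every neighbourhood of it. "Only one singularity, at $x^o$" means that $x^o$ is a singularity of $u$, that $u:\mathbb{R}^n\setminus\{x^o\}\to(0,\infty)$ is locally bounded on $\mathbb{R}^n\setminus\{x^o\}$, and that the equation holds at every $x\neq x^o$. *)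

theory Defs
  imports "HOL-Analysis.Analysis"
begin

text \<open>
  A solution with a singular point \<open>z\<close> is a function on the complement of \<open>z\<close>, represented here
  by a total function whose value at \<open>z\<close> is arbitrary. The neighbourhoods are therefore
  punctured; since a single (finite) value does not affect boundedness, this is the same as
  unboundedness on full neighbourhoods when \<open>u z\<close> is defined.
\<close>

definition is_singularity :: "('a::topological_space \<Rightarrow> real) \<Rightarrow> 'a \<Rightarrow> bool" where
  "is_singularity u z \<longleftrightarrow> (\<forall>U. open U \<longrightarrow> z \<in> U \<longrightarrow> \<not> bounded (u ` (U - {z})))"

definition locally_bounded_on :: "'a::topological_space set \<Rightarrow> ('a \<Rightarrow> real) \<Rightarrow> bool" where
  "locally_bounded_on S u \<longleftrightarrow> (\<forall>x\<in>S. \<exists>U. open U \<and> x \<in> U \<and> bounded (u ` (U \<inter> S)))"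

definition only_singularity :: "('a::topological_space \<Rightarrow> real) \<Rightarrow> 'a \<Rightarrow> bool" where
  "only_singularity u z \<longleftrightarrow> is_singularity u z \<and> locally_bounded_on (- {z}) u"

text \<open>
  Positivity and the equation are required only at the non-singular points. Finiteness of the
  integral is integrability of its (a.e. nonnegative) integrand. The integrand's value at
  \<open>y = x\<close>, and the arbitrary value of \<open>u\<close> at an isolated singularity, only concern null sets.
\<close>

definition riesz_integrand :: "real \<Rightarrow> real \<Rightarrow> (real^'n \<Rightarrow> real) \<Rightarrow> real^'n \<Rightarrow> real^'n \<Rightarrow> real" where
  "riesz_integrand \<alpha> p u x y = 1 / norm (x - y) powr (real CARD('n) - \<alpha>) * u y powr p"

definition positive_solution :: "real \<Rightarrow> real \<Rightarrow> (real^'n \<Rightarrow> real) \<Rightarrow> bool" where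
  "positive_solution \<alpha> p u \<longleftrightarrow>
     u \<in> borel_measurable lebesgue \<and>
     (\<forall>x. \<not> is_singularity u x \<longrightarrow>
        0 < u x \<and>
        integrable lebesgue (riesz_integrand \<alpha> p u x) \<and>
        u x = (\<integral>y. riesz_integrand \<alpha> p u x y \<partial>lebesgue))"

end

theory Submission
  imports Defs
begin

text \<open>
  The proof moves spheres. Write \<open>n\<close> for the dimension, \<open>k\<close> for the Riesz kernel
  \<open>norm v powr (\<alpha> - n)\<close>, and fix a centre \<open>c \<noteq> x0\<close> and a radius \<open>R < dist c x0\<close>. On the ball \<open>B\<close>
  about \<open>c\<close> of radius \<open>R\<close> the function \<open>u\<close> is compared with its Kelvin transform
  \<open>v y = (R / norm (y - c)) powr (n - \<alpha>) * u (inversion c R y)\<close>. The ball avoids the singularity, so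
  \<open>u\<close> is bounded on it; the behaviour of \<open>u\<close> near \<open>x0\<close> and at infinity enters only through \<open>v\<close>, and
  no decay of \<open>u\<close> has to be known. Folding the part of the integral outside \<open>B\<close> into \<open>B\<close> by the
  inversion gives (lemma \<open>kelvin_minus_u\<close>)

  \<open>v y - u y = \<integral>z\<in>B. (k (y - z) - k* y z) * (g z - u z powr p)\<close>,

  where \<open>k*\<close> is a symmetric kernel smaller than \<open>k\<close>, and
  \<open>g z = (R / norm (z - c)) powr (n + \<alpha> - p * (n - \<alpha>)) * v z powr p\<close>. The exponent of the first factor
  is nonnegative exactly when \<open>p\<close> is at most the critical exponent, and then \<open>g \<ge> v powr p\<close> on \<open>B\<close>.

  Let the overshoot set be the part of \<open>B\<close> where \<open>u > v\<close>. Only this set contributes to an upper bound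
  of \<open>u - v\<close>. There \<open>v\<close> is bounded below and \<open>u\<close> above by positive constants, so the power is
  Lipschitz and the supremum of \<open>u - v\<close> is at most a constant times itself times the
  integral of \<open>k\<close> over the overshoot set. If that set has small measure, the total factor is at most
  one half, and the set is empty (lemma \<open>small_overshoot_is_empty\<close>). This applies to all small radii.
  If the overshoot set is empty for some \<open>R\<close>, then \<open>u < v\<close>, since equality at one point would
  force \<open>u = v\<close> almost everywhere on \<open>B\<close>, whereas \<open>v\<close> is unbounded near the inverse point of \<open>x0\<close>
  (lemma \<open>overshoot_empty_imp_strict\<close>; this is where the singularity is used). By dominated
  convergence the overshoot sets of nearby radii then have small measure, hence are empty.
  Nonemptiness is stable under small changes of \<open>R\<close> as well, by continuity. As an interval is
  connected, the overshoot set is empty for every \<open>R < dist c x0\<close>.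

  If \<open>x \<noteq> y\<close> have the same distance from \<open>x0\<close>, take \<open>c\<close> on the line through them, beyond \<open>x\<close>. The
  sphere about \<open>c\<close> whose inversion takes \<open>x\<close> to \<open>y\<close> has radius less than \<open>dist c x0\<close>, so
  \<open>u x \<le> v x\<close>, which is \<open>u y\<close> times a factor that tends to one as \<open>c\<close> goes to infinity. Hence
  \<open>u x \<le> u y\<close>, and symmetry follows by exchanging the points.

  Two preparations are of independent interest. Exponents \<open>p \<le> 0\<close> admit no solution
  (lemma \<open>exponent_pos\<close>). The Jacobian of the inversion is obtained without determinants: inversion
  takes balls to balls of known radius, so by Vitali's covering theorem its effect on volume can be
  read off from small balls (lemma \<open>inversion_measure_eq_lborel\<close>).
\<close>

section \<open>The Riesz kernel\<close>

definition riesz_kernel :: "real \<Rightarrow> 'a::euclidean_space \<Rightarrow> real" where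
  "riesz_kernel \<alpha> v = norm v powr (\<alpha> - real DIM('a))"

lemma riesz_kernel_nonneg [simp]: "0 \<le> riesz_kernel \<alpha> v"
  by (simp add: riesz_kernel_def)

lemma borel_measurable_riesz_kernel [measurable (raw)]:
  fixes f :: "'b \<Rightarrow> 'a::euclidean_space"
  assumes "f \<in> borel_measurable M"
  shows "(\<lambda>x. riesz_kernel \<alpha> (f x)) \<in> borel_measurable M"
  unfolding riesz_kernel_def using assms by measurable

lemma riesz_kernel_ge:
  fixes v :: "'a::euclidean_space"
  assumes "\<alpha> \<le> real DIM('a)" "0 < norm v" "norm v \<le> r"
  shows "r powr (\<alpha> - real DIM('a)) \<le> riesz_kernel \<alpha> v"
  unfolding riesz_kernel_def using assms by (intro powr_mono2') auto

lemma riesz_kernel_le: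
  fixes v :: "'a::euclidean_space"
  assumes "\<alpha> \<le> real DIM('a)" "0 < r" "r \<le> norm v"
  shows "riesz_kernel \<alpha> v \<le> r powr (\<alpha> - real DIM('a))"
  unfolding riesz_kernel_def using assms by (intro powr_mono2') auto

lemma dyadic_scale_exists:
  fixes t :: real
  assumes "0 < t" "t < 1"
  obtains k where "(1/2) ^ Suc k \<le> t" "t < (1/2) ^ k"
proof -
  obtain n where n: "(1/2) ^ n < t"
    using real_arch_pow_inv[of t "1/2"] assms by auto
  define m where "m = (LEAST m. (1/2) ^ m \<le> t)"
  have m: "(1/2) ^ m \<le> t"
    unfolding m_def by (rule LeastI[of _ n]) (use n in auto)
  then obtain k where k: "m = Suc k"
    using assms by (cases m) auto
  have "\<not> (1/2) ^ k \<le> t"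
    using not_less_Least[of k "\<lambda>m. (1/2) ^ m \<le> t"] k m_def by auto
  then show ?thesis
    using that[of k] m k by auto
qed

text \<open>
  On the dyadic annulus with outer radius \<open>r / 2 ^ k\<close> the kernel is comparable to a power of that
  radius, so the annuli contribute a geometric series with ratio \<open>2 powr (- \<alpha>)\<close>.
\<close>

lemma riesz_kernel_ball_bound:
  assumes \<alpha>: "0 < \<alpha>" "\<alpha> \<le> real DIM('a::euclidean_space)"
  obtains C where "C > 0" and "\<And>(x::'a) r. r > 0 \<Longrightarrow>
    (\<integral>\<^sup>+y. ennreal (riesz_kernel \<alpha> (x - y)) * indicator (ball x r) y \<partial>lborel) \<le> ennreal (C * r powr \<alpha>)"
proof -
  let ?N = "real DIM('a)"
  define \<omega> where "\<omega> = unit_ball_vol ?N"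
  have \<omega>: "\<omega> > 0" by (simp add: \<omega>_def)
  define q where "q = (1/2) powr \<alpha>"
  have q: "0 < q" "q < 1"
    using \<alpha> powr_less_mono2[of \<alpha> "1/2" 1] by (auto simp: q_def)
  define C0 where "C0 = \<omega> * 2 powr (?N - \<alpha>)"
  have C0: "C0 > 0" using \<omega> by (simp add: C0_def)
  have "(\<integral>\<^sup>+y. ennreal (riesz_kernel \<alpha> (x - y)) * indicator (ball x r) y \<partial>lborel)
        \<le> ennreal (C0 / (1 - q) * r powr \<alpha>)" if r: "r > 0" for x :: 'a and r
  proof -
    define a where "a k = (r * (1/2) ^ Suc k) powr (\<alpha> - ?N)" for k
    define b where "b k = r * (1/2) ^ k" for k :: nat
    have b: "b k > 0" for k using r by (simp add: b_def)
    have pt: "ennreal (riesz_kernel \<alpha> (x - y)) * indicator (ball x r) y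
        \<le> (\<Sum>k. ennreal (a k) * indicator (ball x (b k)) y)" for y
    proof (cases "y \<in> ball x r \<and> y \<noteq> x")
      case True
      have *: "0 < norm (x - y) / r" "norm (x - y) / r < 1"
        using True r by (auto simp: dist_norm)
      obtain k where k: "(1/2) ^ Suc k \<le> norm (x - y) / r" "norm (x - y) / r < (1/2) ^ k"
        using dyadic_scale_exists[OF *] by blast
      have 1: "y \<in> ball x (b k)"
        using k(2) r by (simp add: b_def dist_norm field_simps)
      have 2: "riesz_kernel \<alpha> (x - y) \<le> a k"
        unfolding a_def by (rule riesz_kernel_le) (use \<alpha> k(1) r in \<open>auto simp: field_simps\<close>)
      have "ennreal (riesz_kernel \<alpha> (x - y)) * indicator (ball x r) y
          \<le> (\<Sum>j\<in>{k}. ennreal (a j) * indicator (ball x (b j)) y)"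
        using 1 2 True by (auto intro: ennreal_leI)
      also have "\<dots> \<le> (\<Sum>k. ennreal (a k) * indicator (ball x (b k)) y)"
        by (rule sum_le_suminf) auto
      finally show ?thesis .
    next
      case False
      then show ?thesis by (auto simp: riesz_kernel_def)
    qed
    have [measurable]: "ball x (b k) \<in> sets borel" for k by simp
    \<comment> \<open>the contribution of the \<open>k\<close>-th annulus is at most the volume of its outer ball times the
      largest value of the kernel\<close>
    have annulus: "ennreal (a k) * emeasure lborel (ball x (b k)) = ennreal (C0 * r powr \<alpha> * q ^ k)" for k
    proof -
      have "(r * (1/2) ^ Suc k) powr (\<alpha> - ?N) * (\<omega> * b k ^ DIM('a)) = C0 * r powr \<alpha> * q ^ k"
      proof -
        have h: "b k ^ DIM('a) = b k powr ?N"
          using b by (simp add: powr_realpow)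
        have h2: "(r * (1/2) ^ Suc k) powr (\<alpha> - ?N) = b k powr (\<alpha> - ?N) * (1/2) powr (\<alpha> - ?N)"
          using r by (subst powr_mult[symmetric]) (auto simp: b_def)
        have h3: "(1/2::real) powr (\<alpha> - ?N) = 2 powr (?N - \<alpha>)"
          by (simp add: powr_divide powr_minus[symmetric] field_simps powr_diff)
        have h4: "b k powr (\<alpha> - ?N) * b k powr ?N = b k powr \<alpha>"
          by (simp add: powr_add[symmetric])
        have h5: "b k powr \<alpha> = r powr \<alpha> * q ^ k"
        proof -
          have "((1/2::real) ^ k) powr \<alpha> = q ^ k"
            by (simp add: q_def powr_powr powr_realpow[symmetric] mult.commute)
          then show ?thesis using r by (simp add: b_def powr_mult)
        qed
        have "(r * (1/2) ^ Suc k) powr (\<alpha> - ?N) * (\<omega> * b k ^ DIM('a))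
            = \<omega> * (1/2) powr (\<alpha> - ?N) * (b k powr (\<alpha> - ?N) * b k powr ?N)"
          unfolding h h2 by (simp add: mult_ac)
        then show ?thesis
          unfolding h3 h4 h5 C0_def by (simp add: mult_ac)
      qed
      then show ?thesis
        using b[of k] \<omega> by (simp add: emeasure_ball a_def \<omega>_def ennreal_mult[symmetric])
    qed
    have "(\<integral>\<^sup>+y. ennreal (riesz_kernel \<alpha> (x - y)) * indicator (ball x r) y \<partial>lborel)
        \<le> (\<integral>\<^sup>+y. (\<Sum>k. ennreal (a k) * indicator (ball x (b k)) y) \<partial>lborel)"
      by (intro nn_integral_mono pt)
    also have "\<dots> = (\<Sum>k. \<integral>\<^sup>+y. ennreal (a k) * indicator (ball x (b k)) y \<partial>lborel)"
      by (rule nn_integral_suminf) auto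
    also have "\<dots> = (\<Sum>k. ennreal (C0 * r powr \<alpha> * q ^ k))"
      by (subst nn_integral_cmult) (auto simp: annulus)
    also have "\<dots> = ennreal (C0 * r powr \<alpha> * (1 / (1 - q)))"
    proof (rule suminf_ennreal_eq)
      show "(\<lambda>k. C0 * r powr \<alpha> * q ^ k) sums (C0 * r powr \<alpha> * (1 / (1 - q)))"
        by (intro sums_mult geometric_sums) (use q in auto)
    qed (use C0 q in auto)
    finally show ?thesis by (simp add: mult_ac)
  qed
  moreover have "C0 / (1 - q) > 0" using C0 q by simp
  ultimately show ?thesis using that by blast
qed

text \<open>
  Outside the ball of radius \<open>r\<close> the kernel is at most \<open>r powr (\<alpha> - n)\<close>.
\<close>

lemma riesz_kernel_set_bound:
  fixes x :: "'a::euclidean_space"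
  assumes \<alpha>: "\<alpha> \<le> real DIM('a)" and r: "r > 0" and A [measurable]: "A \<in> sets borel"
    and C: "(\<integral>\<^sup>+y. ennreal (riesz_kernel \<alpha> (x - y)) * indicator (ball x r) y \<partial>lborel) \<le> c"
  shows "(\<integral>\<^sup>+y. ennreal (riesz_kernel \<alpha> (x - y)) * indicator A y \<partial>lborel)
    \<le> c + ennreal (r powr (\<alpha> - real DIM('a))) * emeasure lborel A"
proof -
  have [measurable]: "ball x r \<in> sets borel" by simp
  have "(\<integral>\<^sup>+y. ennreal (riesz_kernel \<alpha> (x - y)) * indicator A y \<partial>lborel)
    \<le> (\<integral>\<^sup>+y. ennreal (riesz_kernel \<alpha> (x - y)) * indicator (ball x r) y +
          ennreal (r powr (\<alpha> - real DIM('a))) * indicator A y \<partial>lborel)"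
  proof (rule nn_integral_mono)
    fix y
    show "ennreal (riesz_kernel \<alpha> (x - y)) * indicator A y
      \<le> ennreal (riesz_kernel \<alpha> (x - y)) * indicator (ball x r) y +
          ennreal (r powr (\<alpha> - real DIM('a))) * indicator A y"
    proof (cases "y \<in> ball x r")
      case False
      then have "riesz_kernel \<alpha> (x - y) \<le> r powr (\<alpha> - real DIM('a))"
        using assms by (intro riesz_kernel_le) (auto simp: dist_norm)
      then show ?thesis using False by (auto simp: indicator_def intro: ennreal_leI)
    qed (auto simp: indicator_def)
  qed
  also have "\<dots> \<le> c + ennreal (r powr (\<alpha> - real DIM('a))) * emeasure lborel A"
    by (subst nn_integral_add) (auto simp: nn_integral_cmult_indicator intro!: add_mono C)
  finally show ?thesis .
qed

text \<open>
  Uniformity in the point \<open>x\<close> is what makes the comparison on the overshoot set a contraction in the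
  supremum norm.
\<close>

lemma riesz_kernel_small_sets:
  assumes \<alpha>: "0 < \<alpha>" "\<alpha> \<le> real DIM('a::euclidean_space)" and e: "e > 0"
  obtains \<delta> where "\<delta> > 0" and "\<And>(x::'a) A. A \<in> sets borel \<Longrightarrow> emeasure lborel A \<le> ennreal \<delta> \<Longrightarrow>
    (\<integral>\<^sup>+y. ennreal (riesz_kernel \<alpha> (x - y)) * indicator A y \<partial>lborel) \<le> ennreal e"
proof -
  obtain C where C: "C > 0" "\<And>(x::'a) r. r > 0 \<Longrightarrow>
    (\<integral>\<^sup>+y. ennreal (riesz_kernel \<alpha> (x - y)) * indicator (ball x r) y \<partial>lborel) \<le> ennreal (C * r powr \<alpha>)"
    using riesz_kernel_ball_bound[OF \<alpha>] by blast
  define r where "r = (e / (2 * C)) powr (1 / \<alpha>)"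
  have r: "r > 0" "C * r powr \<alpha> = e / 2"
    using C e \<alpha> by (auto simp: r_def powr_powr)
  define s where "s = r powr (\<alpha> - real DIM('a))"
  have s: "s > 0" using r by (simp add: s_def)
  show ?thesis
  proof (rule that[of "e / (2 * s)"])
    fix x :: 'a and A :: "'a set" assume A: "A \<in> sets borel" "emeasure lborel A \<le> ennreal (e / (2 * s))"
    have "(\<integral>\<^sup>+y. ennreal (riesz_kernel \<alpha> (x - y)) * indicator A y \<partial>lborel)
      \<le> ennreal (C * r powr \<alpha>) + ennreal s * emeasure lborel A"
      unfolding s_def using riesz_kernel_set_bound[OF \<alpha>(2) r(1) A(1) C(2)[OF r(1)]] .
    also have "\<dots> \<le> ennreal (C * r powr \<alpha>) + ennreal s * ennreal (e / (2 * s))"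
      by (intro add_mono mult_left_mono A) auto
    also have "\<dots> = ennreal e"
      using r s e by (simp add: ennreal_mult[symmetric] ennreal_plus[symmetric] del: ennreal_plus)
    finally show "(\<integral>\<^sup>+y. ennreal (riesz_kernel \<alpha> (x - y)) * indicator A y \<partial>lborel) \<le> ennreal e" .
  qed (use e s in auto)
qed

lemma riesz_kernel_minus_commute: "riesz_kernel \<alpha> (x - y) = riesz_kernel \<alpha> (y - x)"
  by (simp add: riesz_kernel_def norm_minus_commute)

text \<open>
  If \<open>y\<close> lies far from the ball, the kernel is essentially constant on it; if \<open>y\<close> is within \<open>2 * r\<close>
  of the centre, the ball is contained in the one of radius \<open>3 * r\<close> about \<open>y\<close>. In both cases the average
  over the ball is at most a constant times the value at the centre, a weak form of
  superharmonicity.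
\<close>

lemma riesz_potential_ball_bound:
  assumes \<alpha>: "0 < \<alpha>" "\<alpha> \<le> real DIM('a::euclidean_space)"
  obtains C where "C > 0" and "\<And>(x::'a) y r. r > 0 \<Longrightarrow> x \<noteq> y \<Longrightarrow>
    (\<integral>\<^sup>+z. ennreal (riesz_kernel \<alpha> (z - y)) * indicator (ball x r) z \<partial>lborel)
      \<le> ennreal (C * r ^ DIM('a) * riesz_kernel \<alpha> (x - y))"
proof -
  let ?N = "real DIM('a)"
  obtain C0 where C0: "C0 > 0" "\<And>(x::'a) r. r > 0 \<Longrightarrow>
    (\<integral>\<^sup>+y. ennreal (riesz_kernel \<alpha> (x - y)) * indicator (ball x r) y \<partial>lborel) \<le> ennreal (C0 * r powr \<alpha>)"
    using riesz_kernel_ball_bound[OF \<alpha>] by blast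
  define \<omega> where "\<omega> = unit_ball_vol ?N"
  have \<omega>: "\<omega> > 0" by (simp add: \<omega>_def)
  define C where "C = 2 powr (?N - \<alpha>) * (C0 * 3 powr \<alpha> + \<omega>)"
  have "C > 0" using C0 \<omega> by (simp add: C_def add_pos_pos)
  moreover have "(\<integral>\<^sup>+z. ennreal (riesz_kernel \<alpha> (z - y)) * indicator (ball x r) z \<partial>lborel)
      \<le> ennreal (C * r ^ DIM('a) * riesz_kernel \<alpha> (x - y))" if r: "r > 0" and xy: "x \<noteq> y" for x y :: 'a and r
  proof (cases "norm (x - y) < 2 * r")
    case True
    have "(\<integral>\<^sup>+z. ennreal (riesz_kernel \<alpha> (z - y)) * indicator (ball x r) z \<partial>lborel)
      \<le> (\<integral>\<^sup>+z. ennreal (riesz_kernel \<alpha> (y - z)) * indicator (ball y (3 * r)) z \<partial>lborel)"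
    proof (rule nn_integral_mono)
      fix z
      have "z \<in> ball y (3 * r)" if "z \<in> ball x r"
        using that True dist_triangle[of y z x] by (auto simp: dist_norm norm_minus_commute)
      then show "ennreal (riesz_kernel \<alpha> (z - y)) * indicator (ball x r) z
        \<le> ennreal (riesz_kernel \<alpha> (y - z)) * indicator (ball y (3 * r)) z"
        by (auto simp: indicator_def riesz_kernel_minus_commute)
    qed
    also have "\<dots> \<le> ennreal (C0 * (3 * r) powr \<alpha>)" using C0(2)[of "3 * r" y] r by simp
    also have "\<dots> \<le> ennreal (C * r ^ DIM('a) * riesz_kernel \<alpha> (x - y))"
    proof (rule ennreal_leI)
      have k: "(2 * r) powr (\<alpha> - ?N) \<le> riesz_kernel \<alpha> (x - y)"
        using True xy by (intro riesz_kernel_ge \<alpha>) auto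
      have "C0 * (3 * r) powr \<alpha> = 2 powr (?N - \<alpha>) * (C0 * 3 powr \<alpha>) * r ^ DIM('a) * (2 * r) powr (\<alpha> - ?N)"
        using r by (simp add: powr_mult powr_diff powr_realpow)
      also have "\<dots> \<le> C * r ^ DIM('a) * (2 * r) powr (\<alpha> - ?N)"
        unfolding C_def using r \<omega> by (intro mult_right_mono mult_left_mono) auto
      also have "\<dots> \<le> C * r ^ DIM('a) * riesz_kernel \<alpha> (x - y)"
        using r \<open>C > 0\<close> by (intro mult_left_mono k) auto
      finally show "C0 * (3 * r) powr \<alpha> \<le> C * r ^ DIM('a) * riesz_kernel \<alpha> (x - y)" .
    qed
    finally show ?thesis .
  next
    case False
    define K where "K = 2 powr (?N - \<alpha>) * riesz_kernel \<alpha> (x - y)"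
    have K: "K \<ge> 0" by (simp add: K_def)
    have "riesz_kernel \<alpha> (z - y) \<le> K" if "z \<in> ball x r" for z
    proof -
      have "norm (x - y) / 2 \<le> norm (z - y)"
        using that False norm_triangle_ineq[of "x - z" "z - y"] by (auto simp: dist_norm)
      then have "riesz_kernel \<alpha> (z - y) \<le> (norm (x - y) / 2) powr (\<alpha> - ?N)"
        using xy by (intro riesz_kernel_le \<alpha>) auto
      also have "\<dots> = K"
        using xy by (simp add: K_def riesz_kernel_def powr_divide powr_diff)
      finally show ?thesis .
    qed
    then have "(\<integral>\<^sup>+z. ennreal (riesz_kernel \<alpha> (z - y)) * indicator (ball x r) z \<partial>lborel)
      \<le> (\<integral>\<^sup>+z. ennreal K * indicator (ball x r) z \<partial>lborel)"
      by (intro nn_integral_mono) (auto simp: indicator_def intro: ennreal_leI)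
    also have "\<dots> = ennreal (K * (\<omega> * r ^ DIM('a)))"
      using r \<omega> K by (simp add: nn_integral_cmult_indicator emeasure_ball \<omega>_def ennreal_mult)
    also have "\<dots> \<le> ennreal (C * r ^ DIM('a) * riesz_kernel \<alpha> (x - y))"
    proof (rule ennreal_leI)
      have "\<omega> * (2 powr (?N - \<alpha>) * (r ^ DIM('a) * riesz_kernel \<alpha> (x - y)))
        \<le> (C0 * 3 powr \<alpha> + \<omega>) * (2 powr (?N - \<alpha>) * (r ^ DIM('a) * riesz_kernel \<alpha> (x - y)))"
        using C0 r by (intro mult_right_mono) auto
      then show "K * (\<omega> * r ^ DIM('a)) \<le> C * r ^ DIM('a) * riesz_kernel \<alpha> (x - y)"
        unfolding K_def C_def by (simp only: mult_ac)
    qed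
    finally show ?thesis .
  qed
  ultimately show ?thesis using that by blast
qed

section \<open>Inversion in a sphere\<close>

lemma norm_scaleR_diff_square:
  fixes v w :: "'a::real_inner"
  shows "(norm (s *\<^sub>R v - t *\<^sub>R w))\<^sup>2 = s\<^sup>2 * (norm v)\<^sup>2 - 2 * s * t * (v \<bullet> w) + t\<^sup>2 * (norm w)\<^sup>2"
  unfolding power2_norm_eq_inner
  by (simp add: inner_diff_left inner_diff_right inner_commute power2_eq_square algebra_simps)

definition inversion :: "'a::euclidean_space \<Rightarrow> real \<Rightarrow> 'a \<Rightarrow> 'a" where
  "inversion c R z = c + (R\<^sup>2 / (norm (z - c))\<^sup>2) *\<^sub>R (z - c)"

lemma inversion_centre [simp]: "inversion c R c = c"
  by (simp add: inversion_def)

lemma norm_inversion: "norm (inversion c R z - c) = R\<^sup>2 / norm (z - c)"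
  by (simp add: inversion_def power2_eq_square)

lemma inversion_eq_centre_iff [simp]: "R \<noteq> 0 \<Longrightarrow> inversion c R z = c \<longleftrightarrow> z = c"
  using norm_inversion[of c R z] by (auto simp: inversion_def)

lemma inversion_involution [simp]:
  assumes "R \<noteq> 0"
  shows "inversion c R (inversion c R z) = z"
proof (cases "z = c")
  case False
  have "inversion c R (inversion c R z) - c
      = (R\<^sup>2 / (R\<^sup>2 / norm (z - c))\<^sup>2 * (R\<^sup>2 / (norm (z - c))\<^sup>2)) *\<^sub>R (z - c)"
    by (simp add: inversion_def power2_eq_square)
  also have "R\<^sup>2 / (R\<^sup>2 / norm (z - c))\<^sup>2 * (R\<^sup>2 / (norm (z - c))\<^sup>2) = 1"
    using assms False by (simp add: field_simps power2_eq_square)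
  finally show ?thesis by simp
qed simp

lemma inversion_eq_iff:
  assumes "R \<noteq> 0"
  shows "inversion c R y = z \<longleftrightarrow> y = inversion c R z"
  using assms by (metis inversion_involution)

lemma borel_measurable_inversion [measurable]: "inversion c R \<in> borel_measurable borel"
  unfolding inversion_def by measurable

text \<open>
  The right-hand side is symmetric in \<open>y\<close> and \<open>z\<close>. Symmetry of the reflected kernel and its comparison
  with the Riesz kernel both come from this identity.
\<close>

lemma norm_diff_inversion_square:
  fixes y z c :: "'a::euclidean_space"
  assumes "z \<noteq> c" "R \<noteq> 0"
  shows "(norm (z - c) * norm (y - inversion c R z) / R)\<^sup>2
    = (norm (y - c))\<^sup>2 * (norm (z - c))\<^sup>2 / R\<^sup>2 - 2 * ((y - c) \<bullet> (z - c)) + R\<^sup>2"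
proof -
  define v w where "v = y - c" and "w = z - c"
  have w: "norm w > 0" using assms by (simp add: w_def)
  have "y - inversion c R z = v - (R\<^sup>2 / (norm w)\<^sup>2) *\<^sub>R w"
    by (simp add: inversion_def v_def w_def)
  then have "(norm (y - inversion c R z))\<^sup>2
      = (norm v)\<^sup>2 - 2 * (R\<^sup>2 / (norm w)\<^sup>2) * (v \<bullet> w) + (R\<^sup>2 / (norm w)\<^sup>2)\<^sup>2 * (norm w)\<^sup>2"
    using norm_scaleR_diff_square[of 1 v "R\<^sup>2 / (norm w)\<^sup>2" w] by simp
  then have "(norm w * norm (y - inversion c R z) / R)\<^sup>2 = (norm w)\<^sup>2 / R\<^sup>2 *
      ((norm v)\<^sup>2 - 2 * (R\<^sup>2 / (norm w)\<^sup>2) * (v \<bullet> w) + (R\<^sup>2 / (norm w)\<^sup>2)\<^sup>2 * (norm w)\<^sup>2)"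
    by (simp add: power_mult_distrib power_divide)
  also have "\<dots> = (norm v)\<^sup>2 * (norm w)\<^sup>2 / R\<^sup>2 - 2 * (v \<bullet> w) + R\<^sup>2"
    using w assms by (simp add: field_simps power2_eq_square)
  finally show ?thesis by (simp add: v_def w_def)
qed

lemma norm_inversion_diff_inversion:
  fixes y z c :: "'a::euclidean_space"
  assumes "y \<noteq> c" "z \<noteq> c" "R > 0"
  shows "norm (inversion c R y - inversion c R z) = R\<^sup>2 * norm (y - z) / (norm (y - c) * norm (z - c))"
proof -
  define v w where "v = y - c" and "w = z - c"
  have w: "norm v > 0" "norm w > 0" using assms by (auto simp: w_def v_def)
  have "inversion c R y - inversion c R z = R\<^sup>2 *\<^sub>R ((1 / (norm v)\<^sup>2) *\<^sub>R v - (1 / (norm w)\<^sup>2) *\<^sub>R w)"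
    by (simp add: inversion_def v_def w_def scaleR_diff_right)
  then have 1: "norm (inversion c R y - inversion c R z)
      = R\<^sup>2 * norm ((1 / (norm v)\<^sup>2) *\<^sub>R v - (1 / (norm w)\<^sup>2) *\<^sub>R w)"
    by simp
  have "(norm ((1 / (norm v)\<^sup>2) *\<^sub>R v - (1 / (norm w)\<^sup>2) *\<^sub>R w))\<^sup>2
     = (1 / (norm v)\<^sup>2)\<^sup>2 * (norm v)\<^sup>2 - 2 * (1 / (norm v)\<^sup>2) * (1 / (norm w)\<^sup>2) * (v \<bullet> w)
        + (1 / (norm w)\<^sup>2)\<^sup>2 * (norm w)\<^sup>2"
    by (rule norm_scaleR_diff_square)
  also have "\<dots> = ((norm v)\<^sup>2 - 2 * (v \<bullet> w) + (norm w)\<^sup>2) / (norm v * norm w)\<^sup>2"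
    using w by (simp add: field_simps power2_eq_square)
  also have "(norm v)\<^sup>2 - 2 * (v \<bullet> w) + (norm w)\<^sup>2 = (norm (v - w))\<^sup>2"
    by (simp add: power2_norm_eq_inner inner_diff_left inner_diff_right inner_commute)
  finally have "norm ((1 / (norm v)\<^sup>2) *\<^sub>R v - (1 / (norm w)\<^sup>2) *\<^sub>R w) = norm (v - w) / (norm v * norm w)"
    using w by (intro power2_eq_imp_eq[of "norm _"]) (auto simp: power_divide)
  then show ?thesis using 1 by (simp add: v_def w_def)
qed

lemma inversion_vimage_ball:
  fixes a c :: "'a::euclidean_space"
  assumes r: "0 < r" "r < norm (a - c)" and R: "R > 0"
  defines "D \<equiv> (norm (a - c))\<^sup>2 - r\<^sup>2"
  shows "inversion c R -` ball a r = ball (c + (R\<^sup>2 / D) *\<^sub>R (a - c)) (R\<^sup>2 * r / D)"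
proof (intro set_eqI)
  fix z
  have D: "D > 0" using r by (simp add: D_def power_strict_mono)
  show "z \<in> inversion c R -` ball a r \<longleftrightarrow> z \<in> ball (c + (R\<^sup>2 / D) *\<^sub>R (a - c)) (R\<^sup>2 * r / D)"
  proof (cases "z = c")
    case True
    have "\<not> norm (a - c) < r" "\<not> R\<^sup>2 / D * norm (a - c) < R\<^sup>2 * r / D"
      using r D R by (auto simp: field_simps)
    then show ?thesis using True D by (simp add: dist_norm)
  next
    case False
    define d w where "d = a - c" and "w = z - c"
    have w: "norm w > 0" using False by (simp add: w_def)
    have Dd: "D = (norm d)\<^sup>2 - r\<^sup>2" by (simp add: D_def d_def)
    have "z \<in> inversion c R -` ball a r \<longleftrightarrow> norm (d - (R\<^sup>2 / (norm w)\<^sup>2) *\<^sub>R w) < r"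
      by (simp add: inversion_def dist_norm d_def w_def algebra_simps)
    also have "\<dots> \<longleftrightarrow> (norm (d - (R\<^sup>2 / (norm w)\<^sup>2) *\<^sub>R w))\<^sup>2 < r\<^sup>2"
      using r by (auto intro: power_strict_mono power2_less_imp_less)
    also have "(norm (d - (R\<^sup>2 / (norm w)\<^sup>2) *\<^sub>R w))\<^sup>2
        = (norm d)\<^sup>2 - 2 * (R\<^sup>2 / (norm w)\<^sup>2) * (d \<bullet> w) + (R\<^sup>2 / (norm w)\<^sup>2)\<^sup>2 * (norm w)\<^sup>2"
      using norm_scaleR_diff_square[of 1 d "R\<^sup>2 / (norm w)\<^sup>2" w] by simp
    also have "\<dots> < r\<^sup>2 \<longleftrightarrow> D * (norm w)\<^sup>2 - 2 * R\<^sup>2 * (d \<bullet> w) + R\<^sup>2 * R\<^sup>2 < 0"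
      unfolding Dd using w by (simp add: field_simps power2_eq_square)
    also have "\<dots> \<longleftrightarrow> (norm w)\<^sup>2 - 2 * (R\<^sup>2 / D) * (d \<bullet> w) + (R\<^sup>2 / D)\<^sup>2 * (norm d)\<^sup>2 < (R\<^sup>2 * r / D)\<^sup>2"
    proof -
      have "(norm w)\<^sup>2 - 2 * (R\<^sup>2 / D) * (d \<bullet> w) + (R\<^sup>2 / D)\<^sup>2 * (norm d)\<^sup>2 - (R\<^sup>2 * r / D)\<^sup>2
        = (norm w)\<^sup>2 - 2 * (R\<^sup>2 / D) * (d \<bullet> w) + (R\<^sup>2 / D)\<^sup>2 * D"
        by (simp add: Dd power_mult_distrib power_divide right_diff_distrib diff_divide_distrib)
      also have "\<dots> = (D * (norm w)\<^sup>2 - 2 * R\<^sup>2 * (d \<bullet> w) + R\<^sup>2 * R\<^sup>2) / D"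
        using D by (simp add: field_simps power2_eq_square)
      finally have "(norm w)\<^sup>2 - 2 * (R\<^sup>2 / D) * (d \<bullet> w) + (R\<^sup>2 / D)\<^sup>2 * (norm d)\<^sup>2 < (R\<^sup>2 * r / D)\<^sup>2
          \<longleftrightarrow> (D * (norm w)\<^sup>2 - 2 * R\<^sup>2 * (d \<bullet> w) + R\<^sup>2 * R\<^sup>2) / D < 0"
        by (metis diff_less_0_iff_less)
      also have "\<dots> \<longleftrightarrow> D * (norm w)\<^sup>2 - 2 * R\<^sup>2 * (d \<bullet> w) + R\<^sup>2 * R\<^sup>2 < 0"
        by (meson D divide_less_0_iff not_less_iff_gr_or_eq)
      finally show ?thesis ..
    qed
    also have "(norm w)\<^sup>2 - 2 * (R\<^sup>2 / D) * (d \<bullet> w) + (R\<^sup>2 / D)\<^sup>2 * (norm d)\<^sup>2 = (norm (w - (R\<^sup>2 / D) *\<^sub>R d))\<^sup>2"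
      using norm_scaleR_diff_square[of 1 w "R\<^sup>2 / D" d] by (simp add: inner_commute)
    also have "\<dots> < (R\<^sup>2 * r / D)\<^sup>2 \<longleftrightarrow> norm (w - (R\<^sup>2 / D) *\<^sub>R d) < R\<^sup>2 * r / D"
      using r D R by (auto intro: power_strict_mono power2_less_imp_less)
    also have "\<dots> \<longleftrightarrow> z \<in> ball (c + (R\<^sup>2 / D) *\<^sub>R (a - c)) (R\<^sup>2 * r / D)"
      by (simp add: dist_norm d_def w_def norm_minus_commute algebra_simps)
    finally show ?thesis .
  qed
qed

text \<open>
  The absolute value of the Jacobian determinant of the inversion, as shown by
  \<open>inversion_measure_eq_lborel\<close> below.
\<close>

definition inversion_density :: "'a::euclidean_space \<Rightarrow> real \<Rightarrow> 'a \<Rightarrow> real" where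
  "inversion_density c R z = (R / norm (z - c)) ^ (2 * DIM('a))"

lemma inversion_density_nonneg [simp]: "R \<ge> 0 \<Longrightarrow> 0 \<le> inversion_density c R z"
  by (simp add: inversion_density_def)

lemma borel_measurable_inversion_density [measurable]: "inversion_density c R \<in> borel_measurable borel"
  unfolding inversion_density_def by measurable

lemma inversion_density_eq:
  assumes "R > 0"
  shows "inversion_density c R (z::'a::euclidean_space) = (norm (inversion c R z - c) / R) ^ (2 * DIM('a))"
proof -
  have "norm (inversion c R z - c) / R = R / norm (z - c)"
    using assms by (simp add: norm_inversion power2_eq_square)
  then show ?thesis by (simp add: inversion_density_def)
qed

definition inversion_measure :: "'a::euclidean_space \<Rightarrow> real \<Rightarrow> 'a measure" where
  "inversion_measure c R = distr (density lborel (inversion_density c R)) borel (inversion c R)"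

lemma sets_inversion_measure [simp, measurable_cong]: "sets (inversion_measure c R) = sets borel"
  by (simp add: inversion_measure_def)

lemma emeasure_inversion_measure:
  assumes A [measurable]: "A \<in> sets borel"
  shows "emeasure (inversion_measure c R) A
    = (\<integral>\<^sup>+z. ennreal (inversion_density c R z) * indicator (inversion c R -` A) z \<partial>lborel)"
proof -
  have [measurable]: "inversion c R -` A \<in> sets borel"
    using measurable_sets[OF borel_measurable_inversion A] by simp
  show ?thesis
    unfolding inversion_measure_def
    by (subst emeasure_distr) (auto simp: emeasure_density intro!: nn_integral_cong split: split_indicator)
qed

text \<open>
  The preimage of the ball is again a ball, of radius \<open>R\<^sup>2 * r / ((norm (a - c))\<^sup>2 - r\<^sup>2)\<close>, on which the
  density varies little when \<open>r\<close> is small compared with \<open>norm (a - c)\<close>. The quotient of the two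
  volumes then differs from one by at most the factor \<open>\<theta>\<close>, which tends to one as \<open>t\<close> tends to zero.
\<close>

lemma inversion_measure_ball_bounds:
  fixes a c :: "'a::euclidean_space"
  assumes t: "0 < t" "t < 1" and r: "0 < r" "r \<le> t * norm (a - c)" and R: "R > 0"
  defines "\<theta> \<equiv> ennreal (((1 + t) / (1 - t)) ^ DIM('a))"
  shows "emeasure (inversion_measure c R) (ball a r) \<le> \<theta> * emeasure lborel (ball a r)"
    and "emeasure lborel (ball a r) \<le> \<theta> * emeasure (inversion_measure c R) (ball a r)"
proof -
  let ?n = "DIM('a)"
  define s where "s = norm (a - c)"
  have s: "s > 0" "r < s"
  proof -
    show "s > 0" using r t by (auto simp: s_def zero_less_mult_iff dest: order.strict_trans2)
    then have "t * s < 1 * s" using t by (intro mult_strict_right_mono) auto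
    then show "r < s" using r by (simp add: s_def)
  qed
  define D where "D = s\<^sup>2 - r\<^sup>2"
  have D: "D = (s - r) * (s + r)" "D > 0"
    using s r by (auto simp: D_def power2_eq_square algebra_simps intro: mult_strict_mono)
  have vim: "inversion c R -` ball a r = ball (c + (R\<^sup>2 / D) *\<^sub>R (a - c)) (R\<^sup>2 * r / D)"
    unfolding D_def s_def using inversion_vimage_ball[of r a c R] r(1) s(2) R by (simp add: s_def)
  define \<omega> where "\<omega> = unit_ball_vol (real ?n)"
  have \<omega>: "\<omega> > 0" by (simp add: \<omega>_def)
  have vol: "emeasure lborel (inversion c R -` ball a r) = ennreal (\<omega> * (R\<^sup>2 * r / D) ^ ?n)"
    unfolding vim \<omega>_def by (rule emeasure_ball) (use r D in simp)
  have volB: "emeasure lborel (ball a r) = ennreal (\<omega> * r ^ ?n)"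
    unfolding \<omega>_def by (rule emeasure_ball) (use r in simp)
  have [measurable]: "ball a r \<in> sets borel" by simp
  have [measurable]: "inversion c R -` ball a r \<in> sets borel" unfolding vim by simp
  have dens: "((s - r) / R) ^ (2 * ?n) \<le> inversion_density c R z" "inversion_density c R z \<le> ((s + r) / R) ^ (2 * ?n)"
    if "z \<in> inversion c R -` ball a r" for z
  proof -
    have "dist a (inversion c R z) < r" using that by simp
    then have "s - r \<le> norm (inversion c R z - c)" "norm (inversion c R z - c) \<le> s + r"
      using norm_triangle_ineq[of "a - inversion c R z" "inversion c R z - c"]
            norm_triangle_ineq[of "inversion c R z - a" "a - c"]
      by (auto simp: s_def dist_norm norm_minus_commute)
    then show "((s - r) / R) ^ (2 * ?n) \<le> inversion_density c R z"
       "inversion_density c R z \<le> ((s + r) / R) ^ (2 * ?n)"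
      unfolding inversion_density_eq[OF R] using R s by (intro power_mono divide_right_mono; simp)+
  qed
  have q: "(s + r) / (s - r) \<le> (1 + t) / (1 - t)"
  proof -
    have "(s + r) * (1 - t) \<le> (1 + t) * (s - r)"
      using r by (simp add: s_def algebra_simps)
    then show ?thesis using s t by (simp add: field_simps)
  qed
  have q0: "(s + r) / (s - r) > 0" using s r by simp
  have "emeasure (inversion_measure c R) (ball a r)
      \<le> (\<integral>\<^sup>+z. ennreal (((s + r) / R) ^ (2 * ?n)) * indicator (inversion c R -` ball a r) z \<partial>lborel)"
    unfolding emeasure_inversion_measure[OF \<open>ball a r \<in> sets borel\<close>]
    by (intro nn_integral_mono) (auto split: split_indicator intro!: ennreal_leI dens)
  also have "\<dots> = ennreal (((s + r) / R) ^ (2 * ?n)) * ennreal (\<omega> * (R\<^sup>2 * r / D) ^ ?n)"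
    by (simp add: nn_integral_cmult_indicator vol)
  also have "\<dots> = ennreal (((s + r) / R) ^ (2 * ?n) * (\<omega> * (R\<^sup>2 * r / D) ^ ?n))"
    using s r R by (intro ennreal_mult[symmetric]) (auto simp: \<omega> less_imp_le D)
  also have "((s + r) / R) ^ (2 * ?n) * (\<omega> * (R\<^sup>2 * r / D) ^ ?n) = ((s + r) / (s - r)) ^ ?n * (\<omega> * r ^ ?n)"
  proof -
    have "((s + r) / R)\<^sup>2 * (R\<^sup>2 * r / D) = (s + r) / (s - r) * r"
      using s R r by (simp add: D(1) power2_eq_square)
    then show ?thesis
      by (simp add: power_mult power_mult_distrib[symmetric] mult.left_commute del: power_divide)
  qed
  also have "ennreal \<dots> \<le> ennreal (((1 + t) / (1 - t)) ^ ?n * (\<omega> * r ^ ?n))"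
    using q q0 \<omega> r by (intro ennreal_leI mult_right_mono power_mono) auto
  also have "\<dots> = \<theta> * emeasure lborel (ball a r)"
    unfolding volB \<theta>_def using t r \<omega> by (intro ennreal_mult) auto
  finally show "emeasure (inversion_measure c R) (ball a r) \<le> \<theta> * emeasure lborel (ball a r)" .
  have "emeasure lborel (ball a r) = ennreal (\<omega> * r ^ ?n)" by (rule volB)
  also have "\<dots> \<le> ennreal (((1 + t) / (1 - t)) ^ ?n * (((s - r) / (s + r)) ^ ?n * (\<omega> * r ^ ?n)))"
  proof (rule ennreal_leI)
    have "1 \<le> (1 + t) / (1 - t) * ((s - r) / (s + r))"
    proof -
      have "(s + r) * (1 - t) \<le> (1 + t) * (s - r)"
        using r by (simp add: s_def algebra_simps)
      moreover have "(s + r) * (1 - t) > 0" using s r t by simp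
      ultimately have "1 \<le> ((1 + t) * (s - r)) / ((s + r) * (1 - t))" by (simp add: pos_le_divide_eq)
      then show ?thesis by (simp add: mult.commute)
    qed
    then have "1 * (\<omega> * r ^ ?n) \<le> ((1 + t) / (1 - t) * ((s - r) / (s + r))) ^ ?n * (\<omega> * r ^ ?n)"
      using \<omega> r by (intro mult_right_mono one_le_power) auto
    then show "\<omega> * r ^ ?n \<le> ((1 + t) / (1 - t)) ^ ?n * (((s - r) / (s + r)) ^ ?n * (\<omega> * r ^ ?n))"
      by (simp only: power_mult_distrib mult.assoc mult_1)
  qed
  also have "\<dots> = \<theta> * ennreal (((s - r) / (s + r)) ^ ?n * (\<omega> * r ^ ?n))"
    unfolding \<theta>_def using t r \<omega> s by (intro ennreal_mult) auto
  also have "((s - r) / (s + r)) ^ ?n * (\<omega> * r ^ ?n) = ((s - r) / R) ^ (2 * ?n) * (\<omega> * (R\<^sup>2 * r / D) ^ ?n)"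
  proof -
    have "((s - r) / R)\<^sup>2 * (R\<^sup>2 * r / D) = (s - r) / (s + r) * r"
      using s R r by (simp add: D(1) power2_eq_square)
    then show ?thesis
      by (simp add: power_mult power_mult_distrib[symmetric] mult.left_commute del: power_divide)
  qed
  also have "ennreal \<dots> = ennreal (((s - r) / R) ^ (2 * ?n)) * ennreal (\<omega> * (R\<^sup>2 * r / D) ^ ?n)"
    using s r R by (intro ennreal_mult) (auto simp: \<omega> less_imp_le D)
  also have "\<dots> = (\<integral>\<^sup>+z. ennreal (((s - r) / R) ^ (2 * ?n)) * indicator (inversion c R -` ball a r) z \<partial>lborel)"
    by (simp add: nn_integral_cmult_indicator vol)
  also have "\<dots> \<le> emeasure (inversion_measure c R) (ball a r)"
    unfolding emeasure_inversion_measure[OF \<open>ball a r \<in> sets borel\<close>]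
    by (intro nn_integral_mono) (auto split: split_indicator intro!: ennreal_leI dens)
  finally show "emeasure lborel (ball a r) \<le> \<theta> * emeasure (inversion_measure c R) (ball a r)"
    by (simp add: mult_left_mono)
qed

text \<open>
  Away from the centre the inversion is differentiable and its own inverse, so preimages of null sets
  are null.
\<close>

lemma inversion_measure_null:
  fixes c :: "'a::euclidean_space"
  assumes N: "N \<in> null_sets lborel" and R: "R > 0"
  shows "N \<in> null_sets (inversion_measure c R)"
proof -
  have [measurable]: "N \<in> sets borel" using N by (auto simp: null_sets_def)
  have "negligible (inversion c R ` (N - {c}))"
  proof (rule negligible_differentiable_image_negligible)
    show "negligible (N - {c})"
      using N by (auto simp: negligible_iff_null_sets null_sets_completionI intro!: null_sets_completionI null_set_Diff)
    show "inversion c R differentiable_on (N - {c})"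
      unfolding inversion_def differentiable_on_def power2_norm_eq_inner
      by (auto intro!: derivative_intros)
  qed simp
  then have 1: "AE z in lborel. z \<notin> inversion c R ` (N - {c})"
    by (metis AE_not_in completion.AE_iff_null_sets AE_completion_iff negligible_iff_null_sets)
  have 2: "AE z in lborel. z \<noteq> c" by (simp add: AE_lborel_singleton)
  have "emeasure (inversion_measure c R) N = (\<integral>\<^sup>+z. 0 \<partial>(lborel::'a measure))"
    unfolding emeasure_inversion_measure[OF \<open>N \<in> sets borel\<close>]
  proof (rule nn_integral_cong_AE, use 1 2 in eventually_elim)
    fix z assume z: "z \<notin> inversion c R ` (N - {c})" "z \<noteq> c"
    have "inversion c R z \<notin> N"
      using z R by (metis DiffI image_eqI inversion_eq_centre_iff inversion_involution less_irrefl singletonD)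
    then show "ennreal (inversion_density c R z) * indicator (inversion c R -` N) z = 0" by simp
  qed
  then show ?thesis by (simp add: null_sets_def)
qed

text \<open>
  By Vitali's covering theorem an open set is, up to a null set, a countable disjoint union of balls
  as small as desired, so the bounds for balls add up.
\<close>

lemma inversion_measure_open_bounds:
  fixes V :: "'a::euclidean_space set"
  assumes V: "open V" and t: "0 < t" "t < 1" and R: "R > 0"
  defines "\<theta> \<equiv> ennreal (((1 + t) / (1 - t)) ^ DIM('a))"
  shows "emeasure (inversion_measure c R) V \<le> \<theta> * emeasure lborel V"
    and "emeasure lborel V \<le> \<theta> * emeasure (inversion_measure c R) V"
proof -
  define K where "K = {(a, r). 0 < r \<and> r \<le> t * norm (a - c) \<and> ball a r \<subseteq> V}"
  have "\<exists>i. i \<in> K \<and> x \<in> ball (fst i) (snd i) \<and> snd i < d" if x: "x \<in> V - {c}" "0 < d" for x d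
  proof -
    obtain e where e: "e > 0" "ball x e \<subseteq> V" using V x by (meson DiffD1 open_contains_ball)
    define r where "r = min (min e (d / 2)) (t * norm (x - c))"
    have "r > 0" "r < d" "r \<le> e" "r \<le> t * norm (x - c)"
      using e x t by (auto simp: r_def)
    then have "(x, r) \<in> K" "x \<in> ball x r" "r < d"
      using e by (auto simp: K_def)
    then show ?thesis by (intro exI[of _ "(x, r)"]) auto
  qed
  then obtain C where C: "countable C" "C \<subseteq> K"
     "pairwise (\<lambda>i j. disjnt (ball (fst i) (snd i)) (ball (fst j) (snd j))) C"
     "negligible (V - {c} - (\<Union>i \<in> C. ball (fst i) (snd i)))"
    by (rule Vitali_covering_theorem_balls[of "V - {c}" K fst snd])
  define U where "U = (\<Union>i\<in>C. ball (fst i) (snd i))"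
  have "ball (fst i) (snd i) \<subseteq> V" if "i \<in> C" for i
    using subsetD[OF C(2) that] by (simp add: K_def split_beta)
  then have UV: "U \<subseteq> V" unfolding U_def by blast
  have [measurable]: "U \<in> sets borel" unfolding U_def by (intro borel_open open_UN) auto
  have [measurable]: "V \<in> sets borel" using V by simp
  have null: "V - U \<in> null_sets lborel"
  proof -
    have "V - U \<subseteq> insert c (V - {c} - U)" by auto
    moreover have "negligible (insert c (V - {c} - U))" using C(4) by (simp add: U_def)
    ultimately have "negligible (V - U)" by (rule negligible_subset[rotated])
    then show ?thesis by (simp add: negligible_iff_null_sets null_sets_completion_iff)
  qed
  \<comment> \<open>applied below to both measures that are compared\<close>
  have split: "emeasure M V = (\<integral>\<^sup>+i. emeasure M (ball (fst i) (snd i)) \<partial>count_space C)"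
    if [measurable_cong]: "sets M = sets borel" and M: "V - U \<in> null_sets M" for M :: "'a measure"
  proof -
    have "emeasure M V = emeasure M (U \<union> (V - U))" using UV by (simp add: Un_absorb1)
    also have "\<dots> = emeasure M U" by (rule emeasure_Un_null_set[OF _ M]) simp
    also have "\<dots> = (\<integral>\<^sup>+i. emeasure M (ball (fst i) (snd i)) \<partial>count_space C)"
      unfolding U_def
      by (rule emeasure_UN_countable)
         (use C(1,3) in \<open>auto simp: disjoint_family_on_def pairwise_def disjnt_def that\<close>)
    finally show ?thesis .
  qed
  note split_inv = split[OF sets_inversion_measure inversion_measure_null[OF null R]]
  note split_leb = split[OF sets_lborel null]
  have ball: "0 < snd i" "snd i \<le> t * norm (fst i - c)" if "i \<in> C" for i
    using C(2) that by (auto simp: K_def)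
  show "emeasure (inversion_measure c R) V \<le> \<theta> * emeasure lborel V"
    unfolding split_inv split_leb \<theta>_def
    by (subst nn_integral_cmult[symmetric])
       (auto intro!: nn_integral_mono inversion_measure_ball_bounds ball t R)
  show "emeasure lborel V \<le> \<theta> * emeasure (inversion_measure c R) V"
    unfolding split_inv split_leb \<theta>_def
    by (subst nn_integral_cmult[symmetric])
       (auto intro!: nn_integral_mono inversion_measure_ball_bounds ball t R)
qed

lemma inversion_measure_eq_lborel:
  fixes c :: "'a::euclidean_space"
  assumes R: "R > 0"
  shows "inversion_measure c R = lborel"
proof (rule lborel_eqI[symmetric])
  fix l u :: 'a assume lu: "\<And>b. b \<in> Basis \<Longrightarrow> l \<bullet> b \<le> u \<bullet> b"
  let ?m = "emeasure (inversion_measure c R) (box l u)" and ?v = "emeasure lborel (box l u)"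
  let ?\<theta> = "\<lambda>t::real. ennreal (((1 + t) / (1 - t)) ^ DIM('a))"
  have lim: "(?\<theta> \<longlongrightarrow> 1) (at_right 0)"
  proof -
    have "((\<lambda>t::real. ((1 + t) / (1 - t)) ^ DIM('a)) \<longlongrightarrow> ((1 + 0) / (1 - 0)) ^ DIM('a)) (at_right 0)"
      by (intro tendsto_intros) auto
    then have "((\<lambda>t::real. ((1 + t) / (1 - t)) ^ DIM('a)) \<longlongrightarrow> 1) (at_right 0)" by simp
    from tendsto_ennrealI[OF this] show ?thesis by simp
  qed
  have small: "eventually (\<lambda>t::real. 0 < t \<and> t < 1) (at_right 0)"
    unfolding eventually_at_right[OF zero_less_one] by (intro exI[of _ 1]) auto
  have v: "?v < \<infinity>" by (simp add: emeasure_lborel_box_eq)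
  have m: "?m < \<infinity>"
    using inversion_measure_open_bounds(1)[of "box l u" "1/2" R c] v R
    by (auto simp: ennreal_mult_less_top open_box intro: order.strict_trans1)
  have "?m \<le> 1 * ?v"
  proof (rule tendsto_lowerbound)
    show "((\<lambda>t. ?\<theta> t * ?v) \<longlongrightarrow> 1 * ?v) (at_right 0)"
      using v by (intro tendsto_mult_ennreal lim tendsto_const) auto
    show "eventually (\<lambda>t. ?m \<le> ?\<theta> t * ?v) (at_right 0)"
      using small by eventually_elim (auto intro!: inversion_measure_open_bounds R open_box)
  qed simp
  moreover have "?v \<le> 1 * ?m"
  proof (rule tendsto_lowerbound)
    show "((\<lambda>t. ?\<theta> t * ?m) \<longlongrightarrow> 1 * ?m) (at_right 0)"
      using m by (intro tendsto_mult_ennreal lim tendsto_const) auto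
    show "eventually (\<lambda>t. ?v \<le> ?\<theta> t * ?m) (at_right 0)"
      using small by eventually_elim (auto intro!: inversion_measure_open_bounds R open_box)
  qed simp
  ultimately have "?m = ?v" by simp
  then show "?m = (\<Prod>b\<in>Basis. (u - l) \<bullet> b)"
    using lu by (simp add: emeasure_lborel_box)
qed simp

text \<open>
  The change of variables formula for the inversion.
\<close>

lemma nn_integral_inversion:
  fixes c :: "'a::euclidean_space"
  assumes [measurable]: "h \<in> borel_measurable borel" and R: "R > 0"
  shows "(\<integral>\<^sup>+z. h z \<partial>lborel) = (\<integral>\<^sup>+z. ennreal (inversion_density c R z) * h (inversion c R z) \<partial>lborel)"
proof -
  have "(\<integral>\<^sup>+z. h z \<partial>lborel) = (\<integral>\<^sup>+z. h z \<partial>inversion_measure c R)"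
    by (simp add: inversion_measure_eq_lborel[OF R])
  also have "\<dots> = (\<integral>\<^sup>+z. ennreal (inversion_density c R z) * h (inversion c R z) \<partial>lborel)"
    unfolding inversion_measure_def by (simp add: nn_integral_distr nn_integral_density)
  finally show ?thesis .
qed

text \<open>
  The Riesz kernel between \<open>y\<close> and the inverse point of \<open>z\<close>, normalised so as to be symmetric.
  For \<open>\<alpha> = 2\<close> its difference from the Riesz kernel is, up to a constant, the Green function of the
  ball.
\<close>

definition reflected_kernel :: "real \<Rightarrow> 'a::euclidean_space \<Rightarrow> real \<Rightarrow> 'a \<Rightarrow> 'a \<Rightarrow> real" where
  "reflected_kernel \<alpha> c R y z = (norm (z - c) * norm (y - inversion c R z) / R) powr (\<alpha> - real DIM('a))"

lemma reflected_kernel_nonneg [simp]: "0 \<le> reflected_kernel \<alpha> c R y z"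
  by (simp add: reflected_kernel_def)

lemma borel_measurable_reflected_kernel [measurable]:
  "(\<lambda>z. reflected_kernel \<alpha> c R y z) \<in> borel_measurable borel"
  unfolding reflected_kernel_def by measurable

lemma reflected_kernel_commute:
  assumes "y \<noteq> c" "z \<noteq> c" "R > 0"
  shows "reflected_kernel \<alpha> c R y z = reflected_kernel \<alpha> c R z y"
proof -
  have "(norm (z - c) * norm (y - inversion c R z) / R)\<^sup>2 = (norm (y - c) * norm (z - inversion c R y) / R)\<^sup>2"
    unfolding norm_diff_inversion_square[OF assms(2) less_imp_neq[OF assms(3), symmetric]]
      norm_diff_inversion_square[OF assms(1) less_imp_neq[OF assms(3), symmetric]]
    by (simp add: inner_commute[of "y - c"] mult.commute[of "(norm (y - c))\<^sup>2"])
  then have "norm (z - c) * norm (y - inversion c R z) / R = norm (y - c) * norm (z - inversion c R y) / R"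
    by (rule power2_eq_imp_eq) (use assms in auto)
  then show ?thesis unfolding reflected_kernel_def by (rule arg_cong)
qed

text \<open>
  With \<open>a\<close> and \<open>b\<close> the squared distances of \<open>y\<close> and \<open>z\<close> from \<open>c\<close>, the squared lengths behind the two
  kernels differ by \<open>(R\<^sup>2 - a) * (R\<^sup>2 - b) / R\<^sup>2\<close>, which is positive inside the ball.
\<close>

lemma reflected_kernel_less:
  fixes y z c :: "'a::euclidean_space"
  assumes "\<alpha> < real DIM('a)" "R > 0" "y \<in> ball c R" "z \<in> ball c R" "z \<noteq> c" "y \<noteq> z"
  shows "reflected_kernel \<alpha> c R y z < riesz_kernel \<alpha> (y - z)"
proof -
  define a b where "a = (norm (y - c))\<^sup>2" and "b = (norm (z - c))\<^sup>2"
  have "norm (y - c) < R" "norm (z - c) < R"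
    using assms(3,4) by (simp_all add: dist_norm norm_minus_commute)
  then have ab: "a < R\<^sup>2" "b < R\<^sup>2"
    unfolding a_def b_def by (simp_all add: power_strict_mono)
  define Z where "Z = (R\<^sup>2 - a) * (R\<^sup>2 - b) / R\<^sup>2"
  have "(norm (z - c) * norm (y - inversion c R z) / R)\<^sup>2 = a * b / R\<^sup>2 - 2 * ((y - c) \<bullet> (z - c)) + R\<^sup>2"
    unfolding a_def b_def by (rule norm_diff_inversion_square) (use assms in auto)
  moreover have "(norm (y - z))\<^sup>2 = a - 2 * ((y - c) \<bullet> (z - c)) + b"
    using norm_scaleR_diff_square[of 1 "y - c" 1 "z - c"] by (simp add: a_def b_def)
  moreover have "a * b / R\<^sup>2 + R\<^sup>2 - a - b = Z"
    unfolding Z_def using assms by (simp add: field_simps power2_eq_square)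
  moreover have "Z > 0" unfolding Z_def using ab assms by simp
  ultimately have "(norm (y - z))\<^sup>2 < (norm (z - c) * norm (y - inversion c R z) / R)\<^sup>2" by linarith
  then have "norm (y - z) < norm (z - c) * norm (y - inversion c R z) / R"
    by (rule power2_less_imp_less) (use assms in auto)
  then show ?thesis
    unfolding reflected_kernel_def riesz_kernel_def using assms by (intro powr_less_mono2_neg) auto
qed

lemma riesz_kernel_inversion:
  fixes y z c :: "'a::euclidean_space"
  assumes "z \<noteq> c" "R > 0"
  shows "riesz_kernel \<alpha> (y - inversion c R z)
    = (R / norm (z - c)) powr (\<alpha> - real DIM('a)) * reflected_kernel \<alpha> c R y z"
proof -
  have "norm (y - inversion c R z) = R / norm (z - c) * (norm (z - c) * norm (y - inversion c R z) / R)"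
    using assms by simp
  then have "riesz_kernel \<alpha> (y - inversion c R z)
      = (R / norm (z - c) * (norm (z - c) * norm (y - inversion c R z) / R)) powr (\<alpha> - real DIM('a))"
    unfolding riesz_kernel_def by (rule arg_cong)
  also have "\<dots> = (R / norm (z - c)) powr (\<alpha> - real DIM('a)) * reflected_kernel \<alpha> c R y z"
    unfolding reflected_kernel_def by (rule powr_mult)
  finally show ?thesis .
qed

lemma reflected_kernel_inversion:
  fixes y z c :: "'a::euclidean_space"
  assumes "y \<noteq> c" "z \<noteq> c" "R > 0"
  shows "reflected_kernel \<alpha> c R (inversion c R y) z
    = (R / norm (y - c)) powr (\<alpha> - real DIM('a)) * riesz_kernel \<alpha> (y - z)"
proof -
  have *: "norm (z - c) * norm (inversion c R y - inversion c R z) / R = R / norm (y - c) * norm (y - z)"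
    using assms by (simp add: norm_inversion_diff_inversion power2_eq_square)
  show ?thesis
    unfolding riesz_kernel_def reflected_kernel_def * by (rule powr_mult)
qed

lemma nn_integral_fold_into_ball:
  fixes c :: "'a::euclidean_space"
  assumes [measurable]: "h \<in> borel_measurable borel" and R: "R > 0"
  shows "(\<integral>\<^sup>+z. h z \<partial>lborel) = (\<integral>\<^sup>+z. h z * indicator (ball c R) z \<partial>lborel)
    + (\<integral>\<^sup>+z. ennreal (inversion_density c R z) * h (inversion c R z) * indicator (ball c R) z \<partial>lborel)"
proof -
  have [measurable]: "ball c R \<in> sets borel" by simp
  have "(\<integral>\<^sup>+z. h z \<partial>lborel) = (\<integral>\<^sup>+z. h z * indicator (ball c R) z + h z * indicator (- ball c R) z \<partial>lborel)"
    by (intro nn_integral_cong) (auto simp: indicator_def)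
  also have "\<dots> = (\<integral>\<^sup>+z. h z * indicator (ball c R) z \<partial>lborel) + (\<integral>\<^sup>+z. h z * indicator (- ball c R) z \<partial>lborel)"
    by (rule nn_integral_add) auto
  also have "(\<integral>\<^sup>+z. h z * indicator (- ball c R) z \<partial>lborel)
     = (\<integral>\<^sup>+z. ennreal (inversion_density c R z) * (h (inversion c R z) * indicator (- ball c R) (inversion c R z)) \<partial>lborel)"
    by (rule nn_integral_inversion) (use R in auto)
  also have "\<dots> = (\<integral>\<^sup>+z. ennreal (inversion_density c R z) * h (inversion c R z) * indicator (ball c R) z \<partial>lborel)"
  proof -
    have "sphere c R \<in> null_sets lborel"
      using negligible_sphere[of c R] by (simp add: negligible_iff_null_sets null_sets_completion_iff)
    then have "AE z in lborel. z \<notin> sphere c R" by (rule AE_not_in)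
    moreover have "AE z in lborel. z \<noteq> c" by (rule AE_lborel_singleton)
    ultimately show ?thesis
    proof (intro nn_integral_cong_AE, eventually_elim)
      fix z assume z: "z \<notin> sphere c R" "z \<noteq> c"
      have "inversion c R z \<notin> ball c R \<longleftrightarrow> R \<le> R\<^sup>2 / norm (z - c)"
        by (simp add: dist_norm norm_minus_commute[of c] norm_inversion not_less)
      also have "\<dots> \<longleftrightarrow> z \<in> ball c R"
        using z R by (auto simp: dist_norm norm_minus_commute[of c] field_simps power2_eq_square)
      finally show "ennreal (inversion_density c R z) * (h (inversion c R z) * indicator (- ball c R) (inversion c R z))
        = ennreal (inversion_density c R z) * h (inversion c R z) * indicator (ball c R) z"
        by (simp add: indicator_def)
    qed
  qed
  finally show ?thesis .
qed

section \<open>Solutions with one singularity\<close>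

text \<open>
  The hypotheses on \<open>u\<close> in the form used by the argument: Borel measurability instead of Lebesgue
  measurability, which allows Fubini's theorem, and the integral equation for nonnegative extended
  integrals, where finiteness is implied by the equation itself.
\<close>

locale singular_riesz_solution =
  fixes \<alpha> p :: real and u :: "'a::euclidean_space \<Rightarrow> real" and z0 :: 'a
  assumes alpha_pos: "0 < \<alpha>" and alpha_less: "\<alpha> < real DIM('a)"
    and exponent_le: "p \<le> (real DIM('a) + \<alpha>) / (real DIM('a) - \<alpha>)"
    and u_measurable [measurable]: "u \<in> borel_measurable borel"
    and u_pos: "x \<noteq> z0 \<Longrightarrow> 0 < u x"
    and u_eq: "x \<noteq> z0 \<Longrightarrow>
      ennreal (u x) = (\<integral>\<^sup>+y. ennreal (riesz_kernel \<alpha> (x - y)) * ennreal (u y powr p) \<partial>lborel)"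
    and u_locally_bounded: "x \<noteq> z0 \<Longrightarrow> \<exists>r>0. \<exists>M. \<forall>y\<in>ball x r - {z0}. u y \<le> M"
    and u_singular: "r > 0 \<Longrightarrow> \<exists>y\<in>ball z0 r - {z0}. M < u y"
begin

lemma AE_neq: "AE y in lborel. y \<noteq> (x::'a)"
  by (rule AE_lborel_singleton)

text \<open>
  The part of the integral over the unit ball already decays no faster than the kernel.
\<close>

lemma u_lower_bound:
  obtains c where "c > 0" "\<And>x. x \<noteq> z0 \<Longrightarrow> c * (1 + norm x) powr (\<alpha> - real DIM('a)) \<le> u x"
proof -
  define m where "m = (\<integral>\<^sup>+y. ennreal (u y powr p) * indicator (ball (0::'a) 1) y \<partial>lborel)"
  have [measurable]: "ball (0::'a) 1 \<in> sets borel" by simp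
  have "m \<noteq> 0"
  proof
    assume "m = 0"
    then have "AE y in lborel. ennreal (u y powr p) * indicator (ball (0::'a) 1) y = 0"
      unfolding m_def by (subst (asm) nn_integral_0_iff_AE) auto
    then have "AE y in lborel. y \<notin> ball (0::'a) 1"
      using AE_neq[of z0]
    proof eventually_elim
      fix y assume *: "ennreal (u y powr p) * indicator (ball (0::'a) 1) y = 0" "y \<noteq> z0"
      have "u y powr p > 0" using u_pos[OF *(2)] by simp
      then show "y \<notin> ball 0 1" using *(1) by (auto simp: indicator_def split: if_splits)
    qed
    then have "ball (0::'a) 1 \<in> null_sets lborel" by (subst (asm) AE_iff_null_sets[symmetric]) auto
    then have "negligible (ball (0::'a) 1)"
      by (simp add: negligible_iff_null_sets null_sets_completion_iff)
    then show False using open_not_negligible[of "ball (0::'a) 1"] by simp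
  qed
  define c where "c = enn2real (min m 1)"
  have fin: "min m 1 \<noteq> 0" "min m 1 < top"
    using \<open>m \<noteq> 0\<close> le_less_trans[OF min.cobounded2 ennreal_one_less_top, of m] by (auto simp: min_def)
  then have "c > 0" unfolding c_def enn2real_positive_iff by (simp only: zero_less_iff_neq_zero simp_thms not_False_eq_True)
  have "ennreal c = min m 1" unfolding c_def by (rule ennreal_enn2real[OF fin(2)])
  then have "ennreal c \<le> m" by simp
  note c = \<open>c > 0\<close> this
  have "c * (1 + norm x) powr (\<alpha> - real DIM('a)) \<le> u x" if x: "x \<noteq> z0" for x
  proof -
    have "ennreal (c * (1 + norm x) powr (\<alpha> - real DIM('a))) \<le> m * ennreal ((1 + norm x) powr (\<alpha> - real DIM('a)))"
      using c by (subst ennreal_mult) (auto intro: mult_right_mono)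
    also have "\<dots> = (\<integral>\<^sup>+y. (ennreal (u y powr p) * indicator (ball (0::'a) 1) y) * ennreal ((1 + norm x) powr (\<alpha> - real DIM('a))) \<partial>lborel)"
      unfolding m_def by (subst nn_integral_multc) auto
    also have "\<dots> \<le> (\<integral>\<^sup>+y. ennreal (riesz_kernel \<alpha> (x - y)) * ennreal (u y powr p) \<partial>lborel)"
    proof (rule nn_integral_mono_AE, use AE_neq[of x] in eventually_elim)
      fix y assume y: "y \<noteq> x"
      have "(1 + norm x) powr (\<alpha> - real DIM('a)) \<le> riesz_kernel \<alpha> (x - y)" if "y \<in> ball 0 1"
        using that y alpha_less norm_triangle_ineq4[of x y] by (intro riesz_kernel_ge) (auto simp: dist_norm)
      then show "(ennreal (u y powr p) * indicator (ball (0::'a) 1) y) * ennreal ((1 + norm x) powr (\<alpha> - real DIM('a)))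
          \<le> ennreal (riesz_kernel \<alpha> (x - y)) * ennreal (u y powr p)"
        by (auto simp: indicator_def mult.commute intro!: mult_left_mono ennreal_leI)
    qed
    also have "\<dots> = ennreal (u x)" using u_eq[OF x] by simp
    finally show ?thesis using u_pos[OF x] by simp
  qed
  with c show ?thesis using that by blast
qed

text \<open>
  As a superposition of kernels, \<open>u\<close> inherits the weak superharmonicity of
  \<open>riesz_potential_ball_bound\<close>, by Fubini's theorem.
\<close>

lemma u_ball_average:
  obtains C where "C > 0" "\<And>x r. x \<noteq> z0 \<Longrightarrow> r > 0 \<Longrightarrow>
    (\<integral>\<^sup>+z. ennreal (u z) * indicator (ball x r) z \<partial>lborel) \<le> ennreal (C * r ^ DIM('a) * u x)"
proof -
  obtain C where C: "C > 0" "\<And>(x::'a) y r. r > 0 \<Longrightarrow> x \<noteq> y \<Longrightarrow>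
    (\<integral>\<^sup>+z. ennreal (riesz_kernel \<alpha> (z - y)) * indicator (ball x r) z \<partial>lborel)
      \<le> ennreal (C * r ^ DIM('a) * riesz_kernel \<alpha> (x - y))"
    using riesz_potential_ball_bound[OF alpha_pos less_imp_le[OF alpha_less]] by blast
  have "(\<integral>\<^sup>+z. ennreal (u z) * indicator (ball x r) z \<partial>lborel) \<le> ennreal (C * r ^ DIM('a) * u x)"
    if x: "x \<noteq> z0" and r: "r > 0" for x r
  proof -
    have [measurable]: "ball x r \<in> sets borel" by simp
    have "(\<integral>\<^sup>+z. ennreal (u z) * indicator (ball x r) z \<partial>lborel)
      = (\<integral>\<^sup>+z. (\<integral>\<^sup>+y. (ennreal (riesz_kernel \<alpha> (z - y)) * ennreal (u y powr p)) * indicator (ball x r) z \<partial>lborel) \<partial>lborel)"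
    proof (rule nn_integral_cong_AE, use AE_neq[of z0] in eventually_elim)
      fix z assume z: "z \<noteq> z0"
      have "(\<integral>\<^sup>+y. (ennreal (riesz_kernel \<alpha> (z - y)) * ennreal (u y powr p)) * indicator (ball x r) z \<partial>lborel)
        = (\<integral>\<^sup>+y. ennreal (riesz_kernel \<alpha> (z - y)) * ennreal (u y powr p) \<partial>lborel) * indicator (ball x r) z"
        by (rule nn_integral_multc) measurable
      then show "ennreal (u z) * indicator (ball x r) z
        = (\<integral>\<^sup>+y. (ennreal (riesz_kernel \<alpha> (z - y)) * ennreal (u y powr p)) * indicator (ball x r) z \<partial>lborel)"
        unfolding u_eq[OF z] by (rule sym)
    qed
    also have "\<dots> = (\<integral>\<^sup>+y. (\<integral>\<^sup>+z. (ennreal (riesz_kernel \<alpha> (z - y)) * ennreal (u y powr p)) * indicator (ball x r) z \<partial>lborel) \<partial>lborel)"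
      by (rule lborel_pair.Fubini') measurable
    also have "\<dots> = (\<integral>\<^sup>+y. ennreal (u y powr p) * (\<integral>\<^sup>+z. ennreal (riesz_kernel \<alpha> (z - y)) * indicator (ball x r) z \<partial>lborel) \<partial>lborel)"
    proof (rule nn_integral_cong)
      fix y
      have "(\<integral>\<^sup>+z. (ennreal (riesz_kernel \<alpha> (z - y)) * ennreal (u y powr p)) * indicator (ball x r) z \<partial>lborel)
        = (\<integral>\<^sup>+z. ennreal (u y powr p) * (ennreal (riesz_kernel \<alpha> (z - y)) * indicator (ball x r) z) \<partial>lborel)"
        by (simp only: mult_ac)
      also have "\<dots> = ennreal (u y powr p) * (\<integral>\<^sup>+z. ennreal (riesz_kernel \<alpha> (z - y)) * indicator (ball x r) z \<partial>lborel)"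
        by (rule nn_integral_cmult) measurable
      finally show "(\<integral>\<^sup>+z. (ennreal (riesz_kernel \<alpha> (z - y)) * ennreal (u y powr p)) * indicator (ball x r) z \<partial>lborel)
        = ennreal (u y powr p) * (\<integral>\<^sup>+z. ennreal (riesz_kernel \<alpha> (z - y)) * indicator (ball x r) z \<partial>lborel)" .
    qed
    also have "\<dots> \<le> (\<integral>\<^sup>+y. ennreal (C * r ^ DIM('a)) * (ennreal (riesz_kernel \<alpha> (x - y)) * ennreal (u y powr p)) \<partial>lborel)"
    proof (rule nn_integral_mono_AE, use AE_neq[of x] in eventually_elim)
      fix y assume "y \<noteq> x"
      then have "(\<integral>\<^sup>+z. ennreal (riesz_kernel \<alpha> (z - y)) * indicator (ball x r) z \<partial>lborel)
          \<le> ennreal (C * r ^ DIM('a)) * ennreal (riesz_kernel \<alpha> (x - y))"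
        using C(2)[of r x y] C(1) r by (simp add: ennreal_mult)
      then have "ennreal (u y powr p) * (\<integral>\<^sup>+z. ennreal (riesz_kernel \<alpha> (z - y)) * indicator (ball x r) z \<partial>lborel)
          \<le> ennreal (u y powr p) * (ennreal (C * r ^ DIM('a)) * ennreal (riesz_kernel \<alpha> (x - y)))"
        by (rule mult_left_mono) simp
      then show "ennreal (u y powr p) * (\<integral>\<^sup>+z. ennreal (riesz_kernel \<alpha> (z - y)) * indicator (ball x r) z \<partial>lborel)
          \<le> ennreal (C * r ^ DIM('a)) * (ennreal (riesz_kernel \<alpha> (x - y)) * ennreal (u y powr p))"
        by (simp only: mult_ac)
    qed
    also have "\<dots> = ennreal (C * r ^ DIM('a)) * ennreal (u x)"
      by (subst nn_integral_cmult) (auto simp: u_eq[OF x])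
    also have "\<dots> = ennreal (C * r ^ DIM('a) * u x)"
      using C r u_pos[OF x] by (simp add: ennreal_mult)
    finally show ?thesis .
  qed
  with C(1) show ?thesis using that by blast
qed

text \<open>
  For \<open>p \<le> 0\<close> the equation demands incompatible things of large balls about a fixed point. The averages
  of \<open>u\<close> stay bounded, so \<open>u powr p\<close> is bounded below on a substantial part of the ball; but finiteness
  of the integral forces the average of \<open>u powr p\<close> over a ball of radius \<open>r\<close> to decay like
  \<open>r powr (- \<alpha>)\<close>.
\<close>

lemma exponent_pos: "0 < p"
proof (rule ccontr)
  assume "\<not> 0 < p"
  then have p: "p \<le> 0" by simp
  obtain b :: 'a where "b \<in> Basis" using nonempty_Basis by blast
  then have x: "z0 + b \<noteq> z0" using nonzero_Basis[of b] by auto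
  define x where "x = z0 + b"
  note x = x[folded x_def]
  obtain C where C: "C > 0" and avg: "\<And>x r. x \<noteq> z0 \<Longrightarrow> r > 0 \<Longrightarrow>
    (\<integral>\<^sup>+z. ennreal (u z) * indicator (ball x r) z \<partial>lborel) \<le> ennreal (C * r ^ DIM('a) * u x)"
    using u_ball_average by blast
  have ux: "u x > 0" using u_pos[OF x] .
  define \<omega> where "\<omega> = unit_ball_vol (real DIM('a))"
  have \<omega>: "\<omega> > 0" by (simp add: \<omega>_def)
  \<comment> \<open>the two averages, in one inequality with a free threshold \<open>T\<close> and a free radius \<open>r\<close>\<close>
  have main: "\<omega> \<le> C * u x / T + T powr (- p) * u x * r powr (- \<alpha>)" if T: "T > 0" and r: "r > 0" for T r
  proof -
    have [measurable]: "ball x r \<in> sets borel" by simp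
    have int_f: "(\<integral>\<^sup>+y. ennreal (u y powr p) * indicator (ball x r) y \<partial>lborel) \<le> ennreal (r powr (real DIM('a) - \<alpha>) * u x)"
    proof -
      have "(\<integral>\<^sup>+y. ennreal (u y powr p) * indicator (ball x r) y \<partial>lborel)
        \<le> (\<integral>\<^sup>+y. ennreal (r powr (real DIM('a) - \<alpha>)) * (ennreal (riesz_kernel \<alpha> (x - y)) * ennreal (u y powr p)) \<partial>lborel)"
      proof (rule nn_integral_mono_AE, use AE_neq[of x] in eventually_elim)
        fix y assume y: "y \<noteq> x"
        show "ennreal (u y powr p) * indicator (ball x r) y
          \<le> ennreal (r powr (real DIM('a) - \<alpha>)) * (ennreal (riesz_kernel \<alpha> (x - y)) * ennreal (u y powr p))"
        proof (cases "y \<in> ball x r")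
          case True
          have "r powr (\<alpha> - real DIM('a)) \<le> riesz_kernel \<alpha> (x - y)"
            using True y alpha_less by (intro riesz_kernel_ge) (auto simp: dist_norm)
          then have "r powr (real DIM('a) - \<alpha>) * r powr (\<alpha> - real DIM('a)) \<le> r powr (real DIM('a) - \<alpha>) * riesz_kernel \<alpha> (x - y)"
            by (intro mult_left_mono) auto
          then have "1 * u y powr p \<le> (r powr (real DIM('a) - \<alpha>) * riesz_kernel \<alpha> (x - y)) * u y powr p"
            using r by (intro mult_right_mono) (auto simp: powr_add[symmetric])
          then show ?thesis
            using True by (simp add: ennreal_mult[symmetric] mult.assoc ennreal_leI)
        qed simp
      qed
      also have "\<dots> = ennreal (r powr (real DIM('a) - \<alpha>)) * ennreal (u x)"
        by (subst nn_integral_cmult) (auto simp: u_eq[OF x])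
      finally show ?thesis using ux by (simp add: ennreal_mult)
    qed
    have "ennreal (\<omega> * r ^ DIM('a)) = (\<integral>\<^sup>+y. indicator (ball x r) y \<partial>lborel)"
      using r by (simp add: emeasure_ball \<omega>_def)
    also have "\<dots> \<le> (\<integral>\<^sup>+y. ennreal (1 / T) * (ennreal (u y) * indicator (ball x r) y)
        + ennreal (T powr (- p)) * (ennreal (u y powr p) * indicator (ball x r) y) \<partial>lborel)"
    proof (rule nn_integral_mono_AE, use AE_neq[of z0] in eventually_elim)
      fix y assume y: "y \<noteq> z0"
      have u: "u y > 0" using u_pos[OF y] .
      \<comment> \<open>either \<open>u y\<close> is at least \<open>T\<close>, or its power with exponent \<open>p \<le> 0\<close> is at least that of \<open>T\<close>\<close>
      have "1 \<le> 1 / T * u y + T powr (- p) * u y powr p"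
      proof (cases "T \<le> u y")
        case True
        then have "1 \<le> 1 / T * u y" using T by (simp add: field_simps)
        then show ?thesis using T u by (simp add: add_increasing2)
      next
        case False
        then have "T powr p \<le> u y powr p" using u p T by (intro powr_mono2') auto
        then have "T powr (- p) * T powr p \<le> T powr (- p) * u y powr p" by (intro mult_left_mono) auto
        then have "1 \<le> T powr (- p) * u y powr p" using T by (simp add: powr_add[symmetric])
        then show ?thesis using T u by (simp add: add_increasing)
      qed
      from ennreal_leI[OF this]
      have "1 \<le> ennreal (1 / T) * ennreal (u y) + ennreal (T powr (- p)) * ennreal (u y powr p)"
        using T u by (simp add: ennreal_mult[symmetric] ennreal_plus[symmetric] del: ennreal_plus)
      then show "indicator (ball x r) y \<le> ennreal (1 / T) * (ennreal (u y) * indicator (ball x r) y)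
        + ennreal (T powr (- p)) * (ennreal (u y powr p) * indicator (ball x r) y)"
        by (cases "y \<in> ball x r") simp_all
    qed
    also have "\<dots> \<le> ennreal (1 / T) * ennreal (C * r ^ DIM('a) * u x) + ennreal (T powr (- p)) * ennreal (r powr (real DIM('a) - \<alpha>) * u x)"
    proof -
      have "(\<integral>\<^sup>+y. ennreal (1 / T) * (ennreal (u y) * indicator (ball x r) y)
        + ennreal (T powr (- p)) * (ennreal (u y powr p) * indicator (ball x r) y) \<partial>lborel)
        = ennreal (1 / T) * (\<integral>\<^sup>+y. ennreal (u y) * indicator (ball x r) y \<partial>lborel)
        + ennreal (T powr (- p)) * (\<integral>\<^sup>+y. ennreal (u y powr p) * indicator (ball x r) y \<partial>lborel)"
        by (simp add: nn_integral_add nn_integral_cmult)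
      then show ?thesis using add_mono[OF mult_left_mono[OF avg[OF x r]] mult_left_mono[OF int_f]] by simp
    qed
    also have "\<dots> = ennreal (1 / T * (C * r ^ DIM('a) * u x) + T powr (- p) * (r powr (real DIM('a) - \<alpha>) * u x))"
      using T C r ux by (simp add: ennreal_mult[symmetric] ennreal_plus[symmetric] del: ennreal_plus)
    finally have "\<omega> * r ^ DIM('a) \<le> 1 / T * (C * r ^ DIM('a) * u x) + T powr (- p) * (r powr (real DIM('a) - \<alpha>) * u x)"
      using T C r ux by (subst (asm) ennreal_le_iff) auto
    also have "\<dots> = (C * u x / T + T powr (- p) * u x * r powr (- \<alpha>)) * r ^ DIM('a)"
    proof -
      have "r powr (real DIM('a) - \<alpha>) = r powr (- \<alpha>) * r ^ DIM('a)"
        using r by (simp add: powr_realpow[symmetric] powr_add[symmetric])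
      then show ?thesis by (simp add: algebra_simps)
    qed
    finally show ?thesis using r by simp
  qed
  \<comment> \<open>each of the two terms is made equal to \<open>\<omega> / 4\<close>\<close>
  define T where "T = 4 * C * u x / \<omega>"
  have T: "T > 0" using C ux \<omega> by (simp add: T_def)
  define A where "A = T powr (- p) * u x"
  have A: "A > 0" using T ux by (simp add: A_def)
  define r where "r = (4 * A / \<omega>) powr (1 / \<alpha>)"
  have r: "r > 0" "r powr (- \<alpha>) = \<omega> / (4 * A)"
    using A \<omega> alpha_pos by (auto simp: r_def powr_powr powr_minus)
  have "\<omega> \<le> C * u x / T + A * r powr (- \<alpha>)" using main[OF T r(1)] by (simp add: A_def)
  also have "\<dots> = \<omega> / 4 + \<omega> / 4" unfolding r(2) using A C ux \<omega> by (simp add: T_def)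
  finally show False using \<omega> by simp
qed

lemma riesz_integrable:
  assumes "x \<noteq> z0"
  shows "integrable lborel (\<lambda>y. riesz_kernel \<alpha> (x - y) * u y powr p)"
    and "u x = (\<integral>y. riesz_kernel \<alpha> (x - y) * u y powr p \<partial>lborel)"
proof -
  have nn: "(\<integral>\<^sup>+y. ennreal (riesz_kernel \<alpha> (x - y) * u y powr p) \<partial>lborel) = ennreal (u x)"
    using u_eq[OF assms] by (simp add: ennreal_mult)
  show int: "integrable lborel (\<lambda>y. riesz_kernel \<alpha> (x - y) * u y powr p)"
    by (rule integrableI_nonneg) (auto simp: nn)
  show "u x = (\<integral>y. riesz_kernel \<alpha> (x - y) * u y powr p \<partial>lborel)"
    using nn_integral_eq_integral[OF int] nn u_pos[OF assms] by (simp add: integral_nonneg_AE)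
qed

text \<open>
  Away from \<open>y\<close> the kernels of points near \<open>x1\<close> are at most a constant times the kernel of \<open>x1\<close>, which
  gives an integrable majorant.
\<close>

lemma continuous_far_potential:
  assumes x1: "x1 \<noteq> z0" and \<rho>: "\<rho> > 0"
  shows "isCont (\<lambda>x. \<integral>y. riesz_kernel \<alpha> (x - y) * u y powr p * indicator (- ball x1 \<rho>) y \<partial>lborel) x1"
    (is "isCont ?w x1")
proof -
  have [measurable]: "ball x1 \<rho> \<in> sets borel" by simp
  have "continuous (at x1 within ball x1 (\<rho> / 2)) ?w"
    unfolding continuous_within_sequentially comp_def
  proof (intro allI impI, elim conjE)
    fix s :: "nat \<Rightarrow> 'a" assume s: "\<forall>n. s n \<in> ball x1 (\<rho> / 2)" "s \<longlonglongrightarrow> x1"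
    show "(\<lambda>n. ?w (s n)) \<longlonglongrightarrow> ?w x1"
    proof (rule integral_dominated_convergence[where
        w = "\<lambda>y. 2 powr (real DIM('a) - \<alpha>) * (riesz_kernel \<alpha> (x1 - y) * u y powr p)"])
      show "integrable lborel (\<lambda>y. 2 powr (real DIM('a) - \<alpha>) * (riesz_kernel \<alpha> (x1 - y) * u y powr p))"
        using riesz_integrable(1)[OF x1] by simp
      show "AE y in lborel. (\<lambda>n. riesz_kernel \<alpha> (s n - y) * u y powr p * indicator (- ball x1 \<rho>) y)
          \<longlonglongrightarrow> riesz_kernel \<alpha> (x1 - y) * u y powr p * indicator (- ball x1 \<rho>) y"
        using AE_neq[of x1] by eventually_elim
          (auto simp: riesz_kernel_def intro!: tendsto_intros s)
      show "AE y in lborel. norm (riesz_kernel \<alpha> (s n - y) * u y powr p * indicator (- ball x1 \<rho>) y)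
          \<le> 2 powr (real DIM('a) - \<alpha>) * (riesz_kernel \<alpha> (x1 - y) * u y powr p)" for n
      proof (rule AE_I2)
        fix y
        show "norm (riesz_kernel \<alpha> (s n - y) * u y powr p * indicator (- ball x1 \<rho>) y)
          \<le> 2 powr (real DIM('a) - \<alpha>) * (riesz_kernel \<alpha> (x1 - y) * u y powr p)"
        proof (cases "y \<in> ball x1 \<rho>")
          case False
          have "norm (x1 - s n) < \<rho> / 2" using s(1) by (simp add: dist_norm)
          moreover have "\<rho> \<le> norm (x1 - y)" using False by (simp add: dist_norm)
          ultimately have h: "norm (x1 - y) / 2 \<le> norm (s n - y)"
            using norm_triangle_ineq[of "x1 - s n" "s n - y"] by simp
          have "riesz_kernel \<alpha> (s n - y) \<le> (norm (x1 - y) / 2) powr (\<alpha> - real DIM('a))"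
            using h alpha_less \<open>\<rho> \<le> norm (x1 - y)\<close> \<rho> by (intro riesz_kernel_le) auto
          also have "\<dots> = 2 powr (real DIM('a) - \<alpha>) * riesz_kernel \<alpha> (x1 - y)"
            by (simp add: riesz_kernel_def powr_divide powr_diff)
          finally have "riesz_kernel \<alpha> (s n - y) * u y powr p
            \<le> 2 powr (real DIM('a) - \<alpha>) * riesz_kernel \<alpha> (x1 - y) * u y powr p"
            by (rule mult_right_mono) simp
          then show ?thesis using False by (simp add: mult.assoc)
        qed simp
      qed
    qed auto
  qed
  then show ?thesis
    using \<rho> by (simp add: at_within_open[of x1 "ball x1 (\<rho> / 2)"])
qed

text \<open>
  Near \<open>x1\<close> the power \<open>u powr p\<close> is bounded, because \<open>p > 0\<close>; hence the part of the integral over a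
  small ball about \<open>x1\<close> is uniformly small, and \<open>u\<close> is a locally uniform limit of the far potentials.
\<close>

lemma u_isCont:
  assumes x1: "x1 \<noteq> z0"
  shows "isCont u x1"
proof -
  obtain r0 M0 where r0: "r0 > 0" "\<And>y. y \<in> ball x1 r0 - {z0} \<Longrightarrow> u y \<le> M0"
    using u_locally_bounded[OF x1] by blast
  define r1 where "r1 = min r0 (dist x1 z0)"
  have r1: "r1 > 0" using r0 x1 by (simp add: r1_def)
  have near: "y \<noteq> z0" "u y \<le> M0" if "y \<in> ball x1 r1" for y
    using that r0(2)[of y] by (auto simp: r1_def)
  have M0: "M0 > 0"
    using near(2)[of x1] u_pos[OF x1] r1 by simp
  define M where "M = M0 powr p"
  have M: "M > 0" using M0 by (simp add: M_def)
  have f_le: "u y powr p \<le> M" if "y \<in> ball x1 r1" for y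
    unfolding M_def using near[OF that] u_pos[of y] exponent_pos by (intro powr_mono2) auto
  obtain C where C: "C > 0" "\<And>(x::'a) r. r > 0 \<Longrightarrow>
    (\<integral>\<^sup>+y. ennreal (riesz_kernel \<alpha> (x - y)) * indicator (ball x r) y \<partial>lborel) \<le> ennreal (C * r powr \<alpha>)"
    using riesz_kernel_ball_bound[OF alpha_pos less_imp_le[OF alpha_less]] by blast
  define w where "w \<rho> x = (\<integral>y. riesz_kernel \<alpha> (x - y) * u y powr p * indicator (- ball x1 \<rho>) y \<partial>lborel)" for \<rho> x
  have approx: "\<bar>u x - w \<rho> x\<bar> \<le> M * C * (2 * \<rho>) powr \<alpha>" if \<rho>: "0 < \<rho>" "\<rho> \<le> r1" and x: "x \<in> ball x1 \<rho>" for \<rho> x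
  proof -
    have [measurable]: "ball x1 \<rho> \<in> sets borel" "ball x (2 * \<rho>) \<in> sets borel" by simp_all
    have xz: "x \<noteq> z0" using near(1)[of x] x \<rho> by auto
    note int = riesz_integrable[OF xz]
    have int1: "integrable lborel (\<lambda>y. riesz_kernel \<alpha> (x - y) * u y powr p * indicator (ball x1 \<rho>) y)"
      and int2: "integrable lborel (\<lambda>y. riesz_kernel \<alpha> (x - y) * u y powr p * indicator (- ball x1 \<rho>) y)"
      using int(1) by (auto intro!: integrable_real_mult_indicator)
    have "u x = (\<integral>y. riesz_kernel \<alpha> (x - y) * u y powr p * indicator (ball x1 \<rho>) y
        + riesz_kernel \<alpha> (x - y) * u y powr p * indicator (- ball x1 \<rho>) y \<partial>lborel)"
      unfolding int(2) by (intro Bochner_Integration.integral_cong) (auto simp: indicator_def)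
    also have "\<dots> = (\<integral>y. riesz_kernel \<alpha> (x - y) * u y powr p * indicator (ball x1 \<rho>) y \<partial>lborel) + w \<rho> x"
      unfolding w_def using int1 int2 by (rule Bochner_Integration.integral_add)
    finally have diff: "u x - w \<rho> x = (\<integral>y. riesz_kernel \<alpha> (x - y) * u y powr p * indicator (ball x1 \<rho>) y \<partial>lborel)"
      by simp
    have "ennreal (u x - w \<rho> x) = (\<integral>\<^sup>+y. ennreal (riesz_kernel \<alpha> (x - y) * u y powr p * indicator (ball x1 \<rho>) y) \<partial>lborel)"
      unfolding diff by (rule nn_integral_eq_integral[symmetric, OF int1]) auto
    also have "\<dots> \<le> (\<integral>\<^sup>+y. ennreal M * (ennreal (riesz_kernel \<alpha> (x - y)) * indicator (ball x (2 * \<rho>)) y) \<partial>lborel)"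
    proof (rule nn_integral_mono)
      fix y
      show "ennreal (riesz_kernel \<alpha> (x - y) * u y powr p * indicator (ball x1 \<rho>) y)
          \<le> ennreal M * (ennreal (riesz_kernel \<alpha> (x - y)) * indicator (ball x (2 * \<rho>)) y)"
      proof (cases "y \<in> ball x1 \<rho>")
        case True
        have "dist x y < 2 * \<rho>" using True x dist_triangle[of x y x1] by (simp add: dist_commute)
        moreover have "riesz_kernel \<alpha> (x - y) * u y powr p \<le> M * riesz_kernel \<alpha> (x - y)"
          using f_le[of y] True \<rho> by (subst mult.commute) (auto intro!: mult_right_mono)
        ultimately show ?thesis using True M by (simp add: ennreal_mult[symmetric] ennreal_leI)
      qed simp
    qed
    also have "\<dots> = ennreal M * (\<integral>\<^sup>+y. ennreal (riesz_kernel \<alpha> (x - y)) * indicator (ball x (2 * \<rho>)) y \<partial>lborel)"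
      by (rule nn_integral_cmult) measurable
    also have "\<dots> \<le> ennreal M * ennreal (C * (2 * \<rho>) powr \<alpha>)"
      using C(2)[of "2 * \<rho>" x] \<rho> by (intro mult_left_mono) auto
    also have "\<dots> = ennreal (M * C * (2 * \<rho>) powr \<alpha>)"
      using M C by (simp add: ennreal_mult[symmetric] mult.assoc)
    finally have "u x - w \<rho> x \<le> M * C * (2 * \<rho>) powr \<alpha>" using M C by simp
    moreover have "0 \<le> u x - w \<rho> x" unfolding diff by (rule integral_nonneg_AE) auto
    ultimately show ?thesis by simp
  qed
  show ?thesis
    unfolding continuous_at_eps_delta
  proof (intro allI impI)
    fix e :: real assume e: "e > 0"
    \<comment> \<open>\<open>s\<close> is the radius for which the bound on the near part equals \<open>e / 3\<close>\<close>
    define s where "s = (e / (3 * (M * C))) powr (1 / \<alpha>)"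
    have s: "s > 0" "M * C * s powr \<alpha> = e / 3"
      using e M C alpha_pos by (auto simp: s_def powr_powr)
    define \<rho> where "\<rho> = min r1 (s / 2)"
    have \<rho>: "0 < \<rho>" "\<rho> \<le> r1" "2 * \<rho> \<le> s" using r1 s by (auto simp: \<rho>_def)
    have "M * C * (2 * \<rho>) powr \<alpha> \<le> M * C * s powr \<alpha>"
      using \<rho> M C alpha_pos by (intro mult_left_mono powr_mono2) auto
    then have ap: "\<bar>u x - w \<rho> x\<bar> \<le> e / 3" if "x \<in> ball x1 \<rho>" for x
      using approx[OF \<rho>(1,2) that] s(2) by simp
    obtain d where d: "d > 0" "\<And>x. dist x x1 < d \<Longrightarrow> dist (w \<rho> x) (w \<rho> x1) < e / 3"
      using continuous_far_potential[OF x1 \<rho>(1)] e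
      unfolding w_def[symmetric] continuous_at_eps_delta by (metis divide_pos_pos zero_less_numeral)
    have "dist (u x) (u x1) < e" if "dist x x1 < min d \<rho>" for x
    proof -
      have "\<bar>w \<rho> x - w \<rho> x1\<bar> < e / 3" "\<bar>u x - w \<rho> x\<bar> \<le> e / 3" "\<bar>u x1 - w \<rho> x1\<bar> \<le> e / 3"
        using d(2)[of x] that ap[of x] ap[of x1] \<rho>(1) by (auto simp: dist_real_def dist_commute)
      then have "\<bar>u x - u x1\<bar> < e" by linarith
      then show ?thesis by (simp add: dist_real_def)
    qed
    then show "\<exists>d>0. \<forall>x'. dist x' x1 < d \<longrightarrow> dist (u x') (u x1) < e"
      using d(1) \<rho>(1) by (intro exI[of _ "min d \<rho>"]) auto
  qed
qed

lemma u_bounded_on_cball: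
  assumes "r < dist c z0"
  obtains M where "M > 0" "\<And>y. y \<in> cball c r \<Longrightarrow> u y \<le> M"
proof -
  have "continuous_on (cball c r) u"
    by (rule continuous_at_imp_continuous_on) (use assms u_isCont in force)
  then have "bounded (u ` cball c r)"
    by (intro compact_imp_bounded compact_continuous_image) auto
  then obtain M where "M > 0" "\<forall>v\<in>u ` cball c r. norm v \<le> M" by (auto simp: bounded_pos)
  then show ?thesis by (intro that[of M]) force+
qed

section \<open>The Kelvin transform of a solution\<close>

definition kelvin :: "'a \<Rightarrow> real \<Rightarrow> 'a \<Rightarrow> real" where
  "kelvin c R y = (R / norm (y - c)) powr (real DIM('a) - \<alpha>) * u (inversion c R y)"

text \<open>
  The function that replaces \<open>u powr p\<close> in the integral equation of the Kelvin transform. The exponent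
  of the first factor vanishes exactly for the conformally invariant equation, where \<open>p\<close> is the
  critical exponent.
\<close>

definition kelvin_source :: "'a \<Rightarrow> real \<Rightarrow> 'a \<Rightarrow> real" where
  "kelvin_source c R z =
    (R / norm (z - c)) powr (real DIM('a) + \<alpha> - p * (real DIM('a) - \<alpha>)) * kelvin c R z powr p"

lemma borel_measurable_kelvin [measurable]: "kelvin c R \<in> borel_measurable borel"
  unfolding kelvin_def by measurable

lemma borel_measurable_kelvin_source [measurable]: "kelvin_source c R \<in> borel_measurable borel"
  unfolding kelvin_source_def by measurable

lemma kelvin_source_nonneg [simp]: "0 \<le> kelvin_source c R z"
  by (simp add: kelvin_source_def)

lemma kelvin_pos: "R > 0 \<Longrightarrow> y \<noteq> c \<Longrightarrow> inversion c R y \<noteq> z0 \<Longrightarrow> 0 < kelvin c R y"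
  unfolding kelvin_def using u_pos by simp

lemma kelvin_source_ge:
  assumes "R > 0" "z \<in> ball c R" "z \<noteq> c"
  shows "kelvin c R z powr p \<le> kelvin_source c R z"
proof -
  have "p * (real DIM('a) - \<alpha>) \<le> real DIM('a) + \<alpha>"
    using exponent_le alpha_less by (simp add: pos_le_divide_eq)
  moreover have "1 \<le> R / norm (z - c)"
    using assms by (simp add: dist_norm norm_minus_commute)
  ultimately have "1 \<le> (R / norm (z - c)) powr (real DIM('a) + \<alpha> - p * (real DIM('a) - \<alpha>))"
    by (intro ge_one_powr_ge_zero) auto
  then show ?thesis
    unfolding kelvin_source_def using mult_right_mono[of 1 _ "kelvin c R z powr p"] by simp
qed

lemma AE_inversion_neq:
  assumes "R > 0"
  shows "AE z in lborel. inversion c R z \<noteq> z0"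
  using AE_neq[of "inversion c R z0"] by eventually_elim (use assms in auto)

text \<open>
  The inversion contributes the power \<open>2 * n\<close> of \<open>R / norm (z - c)\<close>, the kernel the power \<open>\<alpha> - n\<close>;
  together they are the power \<open>n + \<alpha>\<close> hidden in \<open>kelvin_source\<close>.
\<close>

lemma u_folded:
  assumes y: "y \<noteq> z0" and R: "R > 0"
  shows "ennreal (u y) =
      (\<integral>\<^sup>+z. ennreal (riesz_kernel \<alpha> (y - z) * u z powr p) * indicator (ball c R) z \<partial>lborel)
    + (\<integral>\<^sup>+z. ennreal (reflected_kernel \<alpha> c R y z * kelvin_source c R z) * indicator (ball c R) z \<partial>lborel)"
proof -
  have "ennreal (u y) = (\<integral>\<^sup>+z. ennreal (riesz_kernel \<alpha> (y - z) * u z powr p) \<partial>lborel)"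
    using u_eq[OF y] by (simp add: ennreal_mult)
  also have "\<dots> = (\<integral>\<^sup>+z. ennreal (riesz_kernel \<alpha> (y - z) * u z powr p) * indicator (ball c R) z \<partial>lborel)
    + (\<integral>\<^sup>+z. ennreal (inversion_density c R z) *
        ennreal (riesz_kernel \<alpha> (y - inversion c R z) * u (inversion c R z) powr p) * indicator (ball c R) z \<partial>lborel)"
    by (rule nn_integral_fold_into_ball) (use R in auto)
  also have "(\<integral>\<^sup>+z. ennreal (inversion_density c R z) *
        ennreal (riesz_kernel \<alpha> (y - inversion c R z) * u (inversion c R z) powr p) * indicator (ball c R) z \<partial>lborel)
    = (\<integral>\<^sup>+z. ennreal (reflected_kernel \<alpha> c R y z * kelvin_source c R z) * indicator (ball c R) z \<partial>lborel)"
  proof (rule nn_integral_cong_AE, use AE_neq[of c] AE_inversion_neq[OF R] in eventually_elim)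
    fix z assume z: "z \<noteq> c" "inversion c R z \<noteq> z0"
    define a where "a = R / norm (z - c)"
    have a: "a > 0" using z R by (simp add: a_def)
    have dens: "inversion_density c R z = a powr (2 * real DIM('a))"
      using a by (simp add: inversion_density_def a_def[symmetric] powr_realpow[symmetric])
    have src: "kelvin_source c R z = a powr (real DIM('a) + \<alpha>) * u (inversion c R z) powr p"
    proof -
      have "kelvin_source c R z = a powr (real DIM('a) + \<alpha> - p * (real DIM('a) - \<alpha>)) *
          (a powr ((real DIM('a) - \<alpha>) * p) * u (inversion c R z) powr p)"
        using a u_pos[OF z(2)]
        by (simp add: kelvin_source_def kelvin_def a_def[symmetric] powr_mult powr_powr)
      also have "\<dots> = a powr (real DIM('a) + \<alpha> - p * (real DIM('a) - \<alpha>) + (real DIM('a) - \<alpha>) * p)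
          * u (inversion c R z) powr p"
        by (simp only: powr_add mult.assoc)
      finally show ?thesis by (simp add: algebra_simps)
    qed
    have "inversion_density c R z * (riesz_kernel \<alpha> (y - inversion c R z) * u (inversion c R z) powr p)
      = reflected_kernel \<alpha> c R y z * kelvin_source c R z"
    proof -
      have "a powr (2 * real DIM('a)) * a powr (\<alpha> - real DIM('a)) = a powr (real DIM('a) + \<alpha>)"
        by (simp add: powr_add[symmetric])
      note e = this
      show ?thesis
        unfolding dens src riesz_kernel_inversion[OF z(1) R] a_def[symmetric] e[symmetric]
        by (simp only: mult_ac)
    qed
    then show "ennreal (inversion_density c R z) *
        ennreal (riesz_kernel \<alpha> (y - inversion c R z) * u (inversion c R z) powr p) * indicator (ball c R) z
      = ennreal (reflected_kernel \<alpha> c R y z * kelvin_source c R z) * indicator (ball c R) z"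
      using R by (simp add: ennreal_mult[symmetric])
  qed
  finally show ?thesis .
qed

text \<open>
  This is \<open>u_folded\<close> at the inverse point of \<open>y\<close>: the inversion exchanges the two kernels, up to a factor
  that the Kelvin transform cancels.
\<close>

lemma kelvin_folded:
  assumes y: "y \<noteq> c" "inversion c R y \<noteq> z0" and R: "R > 0"
  shows "ennreal (kelvin c R y) =
      (\<integral>\<^sup>+z. ennreal (reflected_kernel \<alpha> c R y z * u z powr p) * indicator (ball c R) z \<partial>lborel)
    + (\<integral>\<^sup>+z. ennreal (riesz_kernel \<alpha> (y - z) * kelvin_source c R z) * indicator (ball c R) z \<partial>lborel)"
proof -
  have [measurable]: "ball c R \<in> sets borel" by simp
  define a where "a = (R / norm (y - c)) powr (real DIM('a) - \<alpha>)"
  define b where "b = (R / norm (y - c)) powr (\<alpha> - real DIM('a))"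
  have ab: "a * b = 1" "a \<ge> 0" "b \<ge> 0" using y R by (auto simp: a_def b_def powr_add[symmetric])
  have "ennreal (kelvin c R y) = ennreal a * ennreal (u (inversion c R y))"
    using u_pos[OF y(2)] by (simp add: kelvin_def a_def ennreal_mult)
  also have "\<dots> = ennreal a *
     ((\<integral>\<^sup>+z. ennreal (riesz_kernel \<alpha> (inversion c R y - z) * u z powr p) * indicator (ball c R) z \<partial>lborel)
    + (\<integral>\<^sup>+z. ennreal (reflected_kernel \<alpha> c R (inversion c R y) z * kelvin_source c R z) * indicator (ball c R) z \<partial>lborel))"
    using u_folded[OF y(2) R, of c] by simp
  also have "\<dots> =
     (\<integral>\<^sup>+z. ennreal a * (ennreal (riesz_kernel \<alpha> (inversion c R y - z) * u z powr p) * indicator (ball c R) z) \<partial>lborel)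
    + (\<integral>\<^sup>+z. ennreal a * (ennreal (reflected_kernel \<alpha> c R (inversion c R y) z * kelvin_source c R z) * indicator (ball c R) z) \<partial>lborel)"
    by (simp add: distrib_left nn_integral_cmult)
  also have "(\<integral>\<^sup>+z. ennreal a * (ennreal (riesz_kernel \<alpha> (inversion c R y - z) * u z powr p) * indicator (ball c R) z) \<partial>lborel)
    = (\<integral>\<^sup>+z. ennreal (reflected_kernel \<alpha> c R y z * u z powr p) * indicator (ball c R) z \<partial>lborel)"
  proof (rule nn_integral_cong_AE, use AE_neq[of c] in eventually_elim)
    fix z assume z: "z \<noteq> c"
    have "riesz_kernel \<alpha> (inversion c R y - z) = b * reflected_kernel \<alpha> c R y z"
      unfolding riesz_kernel_minus_commute[of \<alpha> "inversion c R y"] riesz_kernel_inversion[OF y(1) R]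
      by (simp add: b_def reflected_kernel_commute[OF y(1) z R])
    then have eq: "a * (riesz_kernel \<alpha> (inversion c R y - z) * u z powr p) = reflected_kernel \<alpha> c R y z * u z powr p"
      using ab(1) by (simp add: mult.assoc[symmetric])
    show "ennreal a * (ennreal (riesz_kernel \<alpha> (inversion c R y - z) * u z powr p) * indicator (ball c R) z)
      = ennreal (reflected_kernel \<alpha> c R y z * u z powr p) * indicator (ball c R) z"
      unfolding eq[symmetric] by (simp only: ennreal_mult'[OF ab(2)] mult.assoc)
  qed
  also have "(\<integral>\<^sup>+z. ennreal a * (ennreal (reflected_kernel \<alpha> c R (inversion c R y) z * kelvin_source c R z) * indicator (ball c R) z) \<partial>lborel)
    = (\<integral>\<^sup>+z. ennreal (riesz_kernel \<alpha> (y - z) * kelvin_source c R z) * indicator (ball c R) z \<partial>lborel)"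
  proof (rule nn_integral_cong_AE, use AE_neq[of c] in eventually_elim)
    fix z assume z: "z \<noteq> c"
    have eq: "a * (reflected_kernel \<alpha> c R (inversion c R y) z * kelvin_source c R z) = riesz_kernel \<alpha> (y - z) * kelvin_source c R z"
      unfolding reflected_kernel_inversion[OF y(1) z R] b_def[symmetric]
      using ab(1) by (simp add: mult.assoc[symmetric])
    show "ennreal a * (ennreal (reflected_kernel \<alpha> c R (inversion c R y) z * kelvin_source c R z) * indicator (ball c R) z)
      = ennreal (riesz_kernel \<alpha> (y - z) * kelvin_source c R z) * indicator (ball c R) z"
      unfolding eq[symmetric] by (simp only: ennreal_mult'[OF ab(2)] mult.assoc)
  qed
  finally show ?thesis .
qed

lemma kelvin_minus_u:
  assumes y: "y \<noteq> c" "y \<noteq> z0" "inversion c R y \<noteq> z0" and R: "R > 0"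
  defines "G \<equiv> \<lambda>z. (riesz_kernel \<alpha> (y - z) - reflected_kernel \<alpha> c R y z) * (kelvin_source c R z - u z powr p)
      * indicator (ball c R) z"
  shows "integrable lborel G" and "kelvin c R y - u y = (\<integral>z. G z \<partial>lborel)"
proof -
  have [measurable]: "ball c R \<in> sets borel" by simp
  define F1 where "F1 z = riesz_kernel \<alpha> (y - z) * u z powr p * indicator (ball c R) z" for z
  define F2 where "F2 z = reflected_kernel \<alpha> c R y z * kelvin_source c R z * indicator (ball c R) z" for z
  define F3 where "F3 z = reflected_kernel \<alpha> c R y z * u z powr p * indicator (ball c R) z" for z
  define F4 where "F4 z = riesz_kernel \<alpha> (y - z) * kelvin_source c R z * indicator (ball c R) z" for z
  have [measurable]: "F1 \<in> borel_measurable borel" "F2 \<in> borel_measurable borel"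
      "F3 \<in> borel_measurable borel" "F4 \<in> borel_measurable borel"
    unfolding F1_def F2_def F3_def F4_def by measurable
  have nn: "0 \<le> F1 z" "0 \<le> F2 z" "0 \<le> F3 z" "0 \<le> F4 z" for z
    by (auto simp: F1_def F2_def F3_def F4_def)
  have u1: "ennreal (u y) = (\<integral>\<^sup>+z. F1 z \<partial>lborel) + (\<integral>\<^sup>+z. F2 z \<partial>lborel)"
    using u_folded[OF y(2) R, of c] by (simp add: F1_def F2_def ennreal_mult' ennreal_indicator)
  have v1: "ennreal (kelvin c R y) = (\<integral>\<^sup>+z. F3 z \<partial>lborel) + (\<integral>\<^sup>+z. F4 z \<partial>lborel)"
    using kelvin_folded[OF y(1,3) R] by (simp add: F3_def F4_def ennreal_mult' ennreal_indicator)
  have "(\<integral>\<^sup>+z. F1 z \<partial>lborel) + (\<integral>\<^sup>+z. F2 z \<partial>lborel) < \<infinity>" "(\<integral>\<^sup>+z. F3 z \<partial>lborel) + (\<integral>\<^sup>+z. F4 z \<partial>lborel) < \<infinity>"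
    unfolding u1[symmetric] v1[symmetric] by simp_all
  then have int: "integrable lborel F1" "integrable lborel F2" "integrable lborel F3" "integrable lborel F4"
    by (auto intro!: integrableI_nonneg simp: nn)
  have "ennreal (u y) = ennreal ((\<integral>z. F1 z \<partial>lborel) + (\<integral>z. F2 z \<partial>lborel))"
    unfolding u1 using int nn by (simp add: nn_integral_eq_integral integral_nonneg_AE ennreal_plus)
  then have u2: "u y = (\<integral>z. F1 z \<partial>lborel) + (\<integral>z. F2 z \<partial>lborel)"
    using u_pos[OF y(2)] nn
    by (subst (asm) ennreal_inj) (auto intro!: add_nonneg_nonneg integral_nonneg_AE)
  have "ennreal (kelvin c R y) = ennreal ((\<integral>z. F3 z \<partial>lborel) + (\<integral>z. F4 z \<partial>lborel))"
    unfolding v1 using int nn by (simp add: nn_integral_eq_integral integral_nonneg_AE ennreal_plus)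
  then have v2: "kelvin c R y = (\<integral>z. F3 z \<partial>lborel) + (\<integral>z. F4 z \<partial>lborel)"
    using kelvin_pos[OF R y(1,3)] nn
    by (subst (asm) ennreal_inj) (auto intro!: add_nonneg_nonneg integral_nonneg_AE)
  have G: "G = (\<lambda>z. (F3 z + F4 z) - (F1 z + F2 z))"
    by (auto simp: G_def F1_def F2_def F3_def F4_def fun_eq_iff algebra_simps)
  show "integrable lborel G" unfolding G using int by simp
  show "kelvin c R y - u y = (\<integral>z. G z \<partial>lborel)" unfolding G u2 v2 using int by simp
qed

end

section \<open>Moving the spheres\<close>

text \<open>
  By the mean value theorem; the derivative is largest at \<open>M\<close> if \<open>p \<ge> 1\<close> and at \<open>a\<close> otherwise. For
  \<open>p < 1\<close> a positive lower bound \<open>a\<close> is indispensable.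
\<close>

lemma powr_lipschitz_between:
  fixes a M p :: real
  assumes "0 < a" "0 < p"
  obtains L where "L > 0" "\<And>s t. a \<le> s \<Longrightarrow> s \<le> t \<Longrightarrow> t \<le> M \<Longrightarrow> t powr p - s powr p \<le> L * (t - s)"
proof -
  define L where "L = p * max (a powr (p - 1)) (M powr (p - 1))"
  have "L > 0" using assms by (simp add: L_def less_max_iff_disj)
  moreover have "t powr p - s powr p \<le> L * (t - s)" if st: "a \<le> s" "s \<le> t" "t \<le> M" for s t
  proof (cases "s = t")
    case False
    then have "s < t" using st by simp
    then have "\<exists>\<xi>>s. \<xi> < t \<and> t powr p - s powr p = (t - s) * (p * \<xi> powr (p - 1))"
      by (rule MVT2) (use st assms in \<open>auto intro!: derivative_eq_intros simp: powr_diff\<close>)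
    then obtain \<xi> where \<xi>: "s < \<xi>" "\<xi> < t" "t powr p - s powr p = (t - s) * (p * \<xi> powr (p - 1))"
      by blast
    have "\<xi> powr (p - 1) \<le> max (a powr (p - 1)) (M powr (p - 1))"
    proof (cases "p \<ge> 1")
      case True
      then have "\<xi> powr (p - 1) \<le> M powr (p - 1)" using \<xi> st assms by (intro powr_mono2) auto
      then show ?thesis by simp
    next
      case False
      then have "\<xi> powr (p - 1) \<le> a powr (p - 1)" using \<xi> st assms by (intro powr_mono2') auto
      then show ?thesis by simp
    qed
    then have "p * \<xi> powr (p - 1) \<le> L" unfolding L_def using assms by (intro mult_left_mono) auto
    then show ?thesis unfolding \<xi>(3) using \<open>s < t\<close> by (subst mult.commute) (intro mult_right_mono, auto)
  qed simp
  ultimately show ?thesis using that by blast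
qed

context singular_riesz_solution
begin

text \<open>
  Two points are removed: at the centre division by zero gives the Kelvin transform a default value,
  and at the inverse point of the singularity it involves the arbitrary value \<open>u z0\<close>.
\<close>

definition overshoot :: "'a \<Rightarrow> real \<Rightarrow> 'a set" where
  "overshoot c R = {y \<in> ball c R - {c, inversion c R z0}. kelvin c R y < u y}"

lemma overshoot_measurable [measurable]: "overshoot c R \<in> sets borel"
proof -
  have [measurable]: "ball c R - {c, inversion c R z0} \<in> sets borel" by simp
  have "overshoot c R = (ball c R - {c, inversion c R z0}) \<inter> {y \<in> space borel. kelvin c R y < u y}"
    by (auto simp: overshoot_def)
  also have "\<dots> \<in> sets borel" by measurable
  finally show ?thesis .
qed

lemma overshoot_subset_ball: "overshoot c R \<subseteq> ball c R"
  by (auto simp: overshoot_def)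

text \<open>
  The inversion takes the lower bound \<open>u_lower_bound\<close>, with its critical decay, to one by a
  constant, uniformly for all radii up to \<open>R0\<close>.
\<close>

lemma kelvin_lower_bound:
  obtains k where "k > 0" "\<And>R y. 0 < R \<Longrightarrow> R \<le> R0 \<Longrightarrow> y \<in> ball c R - {c, inversion c R z0} \<Longrightarrow> k \<le> kelvin c R y"
proof -
  obtain k where k: "k > 0" "\<And>x. x \<noteq> z0 \<Longrightarrow> k * (1 + norm x) powr (\<alpha> - real DIM('a)) \<le> u x"
    using u_lower_bound by blast
  define k' where "k' = k * (1 + norm c + \<bar>R0\<bar>) powr (\<alpha> - real DIM('a))"
  have "1 + norm c + \<bar>R0\<bar> > 0" by (simp add: add_pos_nonneg)
  then have "k' > 0" using k by (simp add: k'_def)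
  moreover have "k' \<le> kelvin c R y"
    if R: "0 < R" "R \<le> R0" and y: "y \<in> ball c R - {c, inversion c R z0}" for R y
  proof -
    define s where "s = norm (y - c)"
    have s: "0 < s" "s < R" using y by (auto simp: s_def dist_norm norm_minus_commute)
    have inv: "inversion c R y \<noteq> z0" using y R by (auto simp: inversion_eq_iff)
    have "norm (inversion c R y) \<le> norm c + R\<^sup>2 / s"
      using norm_triangle_ineq[of c "inversion c R y - c"] by (simp add: norm_inversion s_def)
    then have 1: "(1 + norm c + R\<^sup>2 / s) powr (\<alpha> - real DIM('a)) \<le> (1 + norm (inversion c R y)) powr (\<alpha> - real DIM('a))"
      using alpha_less by (intro powr_mono2') (auto simp: add_pos_nonneg)
    have pos: "0 < s / R * (1 + norm c) + R" using s R by (intro add_nonneg_pos) auto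
    have le: "s / R * (1 + norm c) + R \<le> 1 + norm c + \<bar>R0\<bar>"
    proof -
      have "s / R * (1 + norm c) \<le> 1 * (1 + norm c)" using s R by (intro mult_right_mono) auto
      then show ?thesis using R by simp
    qed
    have "k' \<le> k * (s / R * (1 + norm c) + R) powr (\<alpha> - real DIM('a))"
      unfolding k'_def using k(1) alpha_less le pos by (intro mult_left_mono powr_mono2') auto
    also have "s / R * (1 + norm c) + R = s / R * (1 + norm c + R\<^sup>2 / s)"
      using s R by (simp add: field_simps power2_eq_square)
    also have "(s / R * (1 + norm c + R\<^sup>2 / s)) powr (\<alpha> - real DIM('a))
        = (R / s) powr (real DIM('a) - \<alpha>) * (1 + norm c + R\<^sup>2 / s) powr (\<alpha> - real DIM('a))"
    proof -
      have "(s / R) powr (\<alpha> - real DIM('a)) = (R / s) powr (real DIM('a) - \<alpha>)"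
        using s R by (simp add: powr_divide powr_diff mult.commute)
      then show ?thesis unfolding powr_mult by simp
    qed
    also have "k * \<dots> \<le> (R / s) powr (real DIM('a) - \<alpha>) * (k * (1 + norm (inversion c R y)) powr (\<alpha> - real DIM('a)))"
      using mult_left_mono[OF 1, of "k * (R / s) powr (real DIM('a) - \<alpha>)"] k(1) by (simp only: mult_ac) simp
    also have "\<dots> \<le> (R / s) powr (real DIM('a) - \<alpha>) * u (inversion c R y)"
      by (intro mult_left_mono k(2) inv) simp
    finally show ?thesis by (simp add: kelvin_def s_def)
  qed
  ultimately show ?thesis using that by blast
qed

text \<open>
  The contraction argument. The supremum \<open>S\<close> of \<open>u - kelvin c R\<close> over the overshoot set is finite since
  \<open>u\<close> is bounded on the ball, and \<open>kelvin_minus_u\<close> bounds it by \<open>L * S\<close> times an integral of the kernel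
  over the overshoot set, hence by \<open>S / 2\<close>.
\<close>

lemma small_overshoot_is_empty:
  assumes R0: "R0 < dist c z0"
  obtains \<delta> where "\<delta> > 0"
    "\<And>R. 0 < R \<Longrightarrow> R \<le> R0 \<Longrightarrow> emeasure lborel (overshoot c R) \<le> ennreal \<delta> \<Longrightarrow> overshoot c R = {}"
proof -
  obtain M where M: "M > 0" "\<And>y. y \<in> cball c R0 \<Longrightarrow> u y \<le> M"
    using u_bounded_on_cball[OF R0] by blast
  obtain k where k: "k > 0"
    "\<And>R y. 0 < R \<Longrightarrow> R \<le> R0 \<Longrightarrow> y \<in> ball c R - {c, inversion c R z0} \<Longrightarrow> k \<le> kelvin c R y"
    using kelvin_lower_bound by blast
  obtain L where L: "L > 0" "\<And>s t. k \<le> s \<Longrightarrow> s \<le> t \<Longrightarrow> t \<le> M \<Longrightarrow> t powr p - s powr p \<le> L * (t - s)"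
    using powr_lipschitz_between[OF k(1) exponent_pos] by blast
  have half: "1 / (2 * L) > 0" using L by simp
  obtain \<delta> where \<delta>: "\<delta> > 0" "\<And>(x::'a) A. A \<in> sets borel \<Longrightarrow> emeasure lborel A \<le> ennreal \<delta> \<Longrightarrow>
    (\<integral>\<^sup>+y. ennreal (riesz_kernel \<alpha> (x - y)) * indicator A y \<partial>lborel) \<le> ennreal (1 / (2 * L))"
    using riesz_kernel_small_sets[OF alpha_pos less_imp_le[OF alpha_less] half] by blast
  have "overshoot c R = {}" if R: "0 < R" "R \<le> R0" and small: "emeasure lborel (overshoot c R) \<le> ennreal \<delta>" for R
  proof (rule ccontr)
    assume ne: "overshoot c R \<noteq> {}"
    define W where "W = (\<lambda>y. u y - kelvin c R y) ` overshoot c R"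
    have in_over: "y \<noteq> c" "y \<noteq> z0" "inversion c R y \<noteq> z0" "u y \<le> M" "k \<le> kelvin c R y" "kelvin c R y < u y"
      "y \<in> ball c R" if "y \<in> overshoot c R" for y
      using that R R0 M(2)[of y] k(2)[of R y] by (auto simp: overshoot_def inversion_eq_iff)
    have bdd: "bdd_above W"
      unfolding W_def using in_over k(1) by (intro bdd_aboveI2[of _ _ M]) force
    define S where "S = Sup W"
    have le_S: "u y - kelvin c R y \<le> S" if "y \<in> overshoot c R" for y
      unfolding S_def by (rule cSup_upper[OF _ bdd]) (use that in \<open>auto simp: W_def\<close>)
    have S: "S > 0" using ne le_S in_over(6) by fastforce
    have "u y - kelvin c R y \<le> S / 2" if y: "y \<in> overshoot c R" for y
    proof -
      define G where "G z = (riesz_kernel \<alpha> (y - z) - reflected_kernel \<alpha> c R y z) *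
          (kelvin_source c R z - u z powr p) * indicator (ball c R) z" for z
      have G: "integrable lborel G" "kelvin c R y - u y = (\<integral>z. G z \<partial>lborel)"
        unfolding G_def using kelvin_minus_u[OF in_over(1,2,3)[OF y] R(1)] by auto
      define K where "K z = riesz_kernel \<alpha> (y - z) * indicator (overshoot c R) z" for z
      have [measurable]: "K \<in> borel_measurable borel" unfolding K_def by measurable
      have K_nn: "(\<integral>\<^sup>+z. ennreal (K z) \<partial>lborel) \<le> ennreal (1 / (2 * L))"
        using \<delta>(2)[OF overshoot_measurable small, of y] by (simp add: K_def ennreal_mult' ennreal_indicator)
      have K0: "0 \<le> K z" for z by (simp add: K_def)
      have K_int: "integrable lborel K"
        by (rule integrableI_nonneg) (use K0 K_nn in \<open>auto intro: le_less_trans\<close>)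
      have "ennreal (\<integral>z. K z \<partial>lborel) \<le> ennreal (1 / (2 * L))"
        using K_nn nn_integral_eq_integral[OF K_int] K0 by simp
      then have K_le: "(\<integral>z. K z \<partial>lborel) \<le> 1 / (2 * L)" using half by simp
      have "u y - kelvin c R y = (\<integral>z. - G z \<partial>lborel)" using G by simp
      \<comment> \<open>off the overshoot set the integrand has the favourable sign and is dropped\<close>
      also have "\<dots> \<le> (\<integral>z. L * S * K z \<partial>lborel)"
      proof (rule integral_mono_AE)
        show "AE z in lborel. - G z \<le> L * S * K z"
          using AE_neq[of c] AE_neq[of y] AE_neq[of "inversion c R z0"]
        proof eventually_elim
          fix z assume z: "z \<noteq> c" "z \<noteq> y" "z \<noteq> inversion c R z0"
          show "- G z \<le> L * S * K z"
          proof (cases "z \<in> ball c R")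
            case False
            then show ?thesis using L S K0[of z] by (simp add: G_def)
          next
            case True
            then have zz: "z \<noteq> z0" using R R0 by auto
            define d where "d = riesz_kernel \<alpha> (y - z) - reflected_kernel \<alpha> c R y z"
            have d: "0 \<le> d" "d \<le> riesz_kernel \<alpha> (y - z)"
              using reflected_kernel_less[OF alpha_less R(1) in_over(7)[OF y] True z(1)] z(2)
              by (auto simp: d_def)
            have src: "kelvin c R z powr p \<le> kelvin_source c R z"
              by (rule kelvin_source_ge[OF R(1) True z(1)])
            have G_eq: "- G z = d * (u z powr p - kelvin_source c R z)"
              using True by (simp add: G_def d_def algebra_simps)
            show ?thesis
            proof (cases "z \<in> overshoot c R")
              case False
              then have "u z \<le> kelvin c R z" using True z by (auto simp: overshoot_def)
              then have "u z powr p \<le> kelvin c R z powr p"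
                using u_pos[OF zz] exponent_pos by (intro powr_mono2) auto
              then have "- G z \<le> 0" unfolding G_eq using src d by (intro mult_nonneg_nonpos) auto
              also have "0 \<le> L * S * K z" using L S K0[of z] by simp
              finally show ?thesis .
            next
              case True
              note zb = in_over[OF True]
              have "u z powr p - kelvin_source c R z \<le> u z powr p - kelvin c R z powr p" using src by simp
              also have "\<dots> \<le> L * (u z - kelvin c R z)" using zb by (intro L(2)) auto
              also have "\<dots> \<le> L * S" using L le_S[OF True] by (intro mult_left_mono) auto
              finally have "- G z \<le> d * (L * S)" unfolding G_eq using d by (intro mult_left_mono)
              also have "\<dots> \<le> riesz_kernel \<alpha> (y - z) * (L * S)" using d L S by (intro mult_right_mono) auto
              finally show ?thesis using True by (simp add: K_def mult.commute)
            qed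
          qed
        qed
      qed (use G K_int in auto)
      also have "\<dots> = L * S * (\<integral>z. K z \<partial>lborel)" by simp
      also have "\<dots> \<le> L * S * (1 / (2 * L))" using L S K_le by (intro mult_left_mono) auto
      also have "\<dots> = S / 2" using L by simp
      finally show ?thesis .
    qed
    then have "S \<le> S / 2"
      unfolding S_def W_def[symmetric] using ne by (intro cSup_least) (auto simp: W_def)
    then show False using S by simp
  qed
  with \<delta>(1) show ?thesis using that by blast
qed

lemma overshoot_empty_for_small_radius:
  assumes "c \<noteq> z0"
  obtains R where "0 < R" "R < dist c z0" "overshoot c R = {}"
proof -
  define R0 where "R0 = dist c z0 / 2"
  have R0: "0 < R0" "R0 < dist c z0" using assms by (auto simp: R0_def)
  obtain \<delta> where \<delta>: "\<delta> > 0"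
    "\<And>R. 0 < R \<Longrightarrow> R \<le> R0 \<Longrightarrow> emeasure lborel (overshoot c R) \<le> ennreal \<delta> \<Longrightarrow> overshoot c R = {}"
    using small_overshoot_is_empty[OF R0(2)] by blast
  define \<omega> where "\<omega> = unit_ball_vol (real DIM('a))"
  have \<omega>: "\<omega> > 0" by (simp add: \<omega>_def)
  define R where "R = min R0 (min 1 (\<delta> / \<omega>))"
  have R: "0 < R" "R \<le> R0" "R \<le> 1" "R \<le> \<delta> / \<omega>" using R0 \<delta> \<omega> by (auto simp: R_def)
  have "R ^ DIM('a) \<le> R ^ 1" using R by (intro power_decreasing) (auto simp: Suc_leI)
  then have "\<omega> * R ^ DIM('a) \<le> \<omega> * (\<delta> / \<omega>)" using R \<omega> by (intro mult_left_mono) auto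
  then have vol: "\<omega> * R ^ DIM('a) \<le> \<delta>" using \<omega> by simp
  have "emeasure lborel (overshoot c R) \<le> emeasure lborel (ball c R)"
    by (rule emeasure_mono[OF overshoot_subset_ball]) simp
  also have "\<dots> \<le> ennreal \<delta>"
    using R vol by (simp add: emeasure_ball \<omega>_def ennreal_leI)
  finally have "overshoot c R = {}" using \<delta>(2) R by blast
  with R R0 that show ?thesis by force
qed

lemma isCont_kelvin:
  assumes "y \<noteq> c" "inversion c R y \<noteq> z0" "R > 0"
  shows "isCont (kelvin c R) y"
proof -
  have "isCont (inversion c R) y" unfolding inversion_def using assms by (intro continuous_intros) auto
  then have "isCont (\<lambda>y. u (inversion c R y)) y" using isCont_o2[of y "inversion c R" u] u_isCont[OF assms(2)] by simp
  then show ?thesis unfolding kelvin_def using assms by (intro continuous_intros) auto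
qed

lemma tendsto_kelvin_radius:
  assumes "y \<noteq> c" "inversion c R y \<noteq> z0" "R > 0"
  shows "((\<lambda>R. kelvin c R y) \<longlongrightarrow> kelvin c R y) (nhds R)"
proof -
  have "((\<lambda>R. inversion c R y) \<longlongrightarrow> inversion c R y) (nhds R)"
    unfolding inversion_def using assms by (intro tendsto_intros filterlim_ident) auto
  then have "((\<lambda>R. u (inversion c R y)) \<longlongrightarrow> u (inversion c R y)) (nhds R)"
    by (rule isCont_tendsto_compose[OF u_isCont[OF assms(2)]])
  then show ?thesis unfolding kelvin_def using assms by (intro tendsto_intros filterlim_ident) auto
qed

text \<open>
  Equality at one point makes the integral of a nonnegative function vanish, so that \<open>u\<close> agrees with
  its Kelvin transform almost everywhere on the ball. But the Kelvin transform exceeds any bound of \<open>u\<close>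
  on a nonempty open set near the inverse point of the singularity.
\<close>

lemma overshoot_empty_imp_strict:
  assumes R: "0 < R" "R < dist c z0" and empty: "overshoot c R = {}"
    and y: "y \<in> ball c R - {c, inversion c R z0}"
  shows "u y < kelvin c R y"
proof (rule ccontr)
  assume neg: "\<not> u y < kelvin c R y"
  have le: "u z \<le> kelvin c R z" if "z \<in> ball c R - {c, inversion c R z0}" for z
    using empty that by (force simp: overshoot_def)
  have eq: "kelvin c R y - u y = 0" using neg le[OF y] by simp
  have yy: "y \<noteq> c" "y \<noteq> z0" "inversion c R y \<noteq> z0" "y \<in> ball c R"
    using y R by (auto simp: inversion_eq_iff)
  define G where "G z = (riesz_kernel \<alpha> (y - z) - reflected_kernel \<alpha> c R y z) *
      (kelvin_source c R z - u z powr p) * indicator (ball c R) z" for z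
  have G: "integrable lborel G" "(\<integral>z. G z \<partial>lborel) = 0"
    unfolding G_def using kelvin_minus_u[OF yy(1-3) R(1)] eq by auto
  have pointwise: "0 \<le> u z powr p \<and> u z powr p \<le> kelvin c R z powr p \<and> kelvin c R z powr p \<le> kelvin_source c R z
      \<and> 0 < riesz_kernel \<alpha> (y - z) - reflected_kernel \<alpha> c R y z"
    if z: "z \<noteq> c" "z \<noteq> y" "z \<noteq> inversion c R z0" "z \<in> ball c R" for z
  proof -
    have "z \<noteq> z0" using z R by auto
    then have "u z powr p \<le> kelvin c R z powr p"
      using u_pos[of z] le[of z] z exponent_pos by (intro powr_mono2) auto
    then show ?thesis
      using kelvin_source_ge[OF R(1) z(4,1)] reflected_kernel_less[OF alpha_less R(1) yy(4) z(4,1)] z(2) by auto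
  qed
  have "AE z in lborel. 0 \<le> G z"
    using AE_neq[of c] AE_neq[of y] AE_neq[of "inversion c R z0"]
  proof eventually_elim
    fix z assume "z \<noteq> c" "z \<noteq> y" "z \<noteq> inversion c R z0"
    then show "0 \<le> G z" using pointwise[of z] by (cases "z \<in> ball c R") (auto simp: G_def)
  qed
  then have "AE z in lborel. G z = 0"
    using integral_nonneg_eq_0_iff_AE[OF G(1)] G(2) by simp
  then have AE: "AE z in lborel. z \<in> ball c R \<longrightarrow> kelvin c R z \<le> u z"
    using AE_neq[of c] AE_neq[of y] AE_neq[of "inversion c R z0"]
  proof eventually_elim
    fix z assume z: "G z = 0" "z \<noteq> c" "z \<noteq> y" "z \<noteq> inversion c R z0"
    show "z \<in> ball c R \<longrightarrow> kelvin c R z \<le> u z"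
    proof (intro impI leI notI)
      assume zb: "z \<in> ball c R" and less: "u z < kelvin c R z"
      have "z \<noteq> z0" using zb R by auto
      then have "0 < u z" by (rule u_pos)
      then have "u z powr p < kelvin c R z powr p"
        using less exponent_pos by (intro powr_less_mono2) auto
      then have "0 < G z" using pointwise[OF z(2-4) zb] zb by (simp add: G_def)
      then show False using z(1) by simp
    qed
  qed
  obtain M where M: "M > 0" "\<And>y. y \<in> cball c R \<Longrightarrow> u y \<le> M"
    using u_bounded_on_cball[OF R(2)] by blast
  define U where "U = ball c R - {c, inversion c R z0}"
  have "open U" unfolding U_def by auto
  moreover have "continuous_on U (kelvin c R)"
    unfolding U_def using R by (intro continuous_at_imp_continuous_on ballI isCont_kelvin) (auto simp: inversion_eq_iff)
  ultimately have open_large: "open (U \<inter> kelvin c R -` {M<..})"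
    by (intro continuous_open_preimage) auto
  have "U \<inter> kelvin c R -` {M<..} \<noteq> {}"
  proof -
    \<comment> \<open>a point \<open>w\<close> near the singularity, and outside the ball, with a large value; its inverse point
      lies in the ball, where the Kelvin factor is at least one\<close>
    obtain w where w: "w \<in> ball z0 (dist c z0 - R) - {z0}" "M < u w"
      using u_singular[of "dist c z0 - R" M] R(2) by (metis diff_gt_0_iff_gt)
    have cw: "R < norm (w - c)"
      using w(1) dist_triangle[of c z0 w] by (auto simp: dist_norm norm_minus_commute)
    then have wc: "w \<noteq> c" using R by auto
    define z where "z = inversion c R w"
    have nz: "norm (z - c) = R\<^sup>2 / norm (w - c)" by (simp add: z_def norm_inversion)
    have pos: "norm (w - c) > 0" using wc by simp
    have lt: "norm (z - c) < R"
      unfolding nz using cw R pos by (simp add: divide_less_eq power2_eq_square)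
    have zw: "inversion c R z = w" using R by (simp add: z_def)
    have "z \<in> U"
      using lt wc w(1) R zw by (auto simp: U_def dist_norm norm_minus_commute inversion_eq_iff z_def)
    moreover have "u w \<le> kelvin c R z"
    proof -
      have "z \<noteq> c" using wc R by (simp add: z_def)
      then have "1 \<le> R / norm (z - c)" using lt by simp
      then have "1 \<le> (R / norm (z - c)) powr (real DIM('a) - \<alpha>)"
        using alpha_less by (intro ge_one_powr_ge_zero) auto
      then have "1 * u w \<le> (R / norm (z - c)) powr (real DIM('a) - \<alpha>) * u w"
        using u_pos[of w] w(1) by (intro mult_right_mono) auto
      then show ?thesis by (simp add: kelvin_def zw)
    qed
    ultimately show ?thesis using w(2) by auto
  qed
  then have "\<not> negligible (U \<inter> kelvin c R -` {M<..})" by (rule open_not_negligible[OF open_large])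
  moreover have "AE z in lborel. z \<notin> U \<inter> kelvin c R -` {M<..}"
    using AE
  proof eventually_elim
    fix z assume *: "z \<in> ball c R \<longrightarrow> kelvin c R z \<le> u z"
    show "z \<notin> U \<inter> kelvin c R -` {M<..}"
    proof
      assume "z \<in> U \<inter> kelvin c R -` {M<..}"
      then have "z \<in> ball c R" "M < kelvin c R z" by (auto simp: U_def)
      then show False using * M(2)[of z] by simp
    qed
  qed
  then have "U \<inter> kelvin c R -` {M<..} \<in> null_sets lborel"
    using open_large by (subst AE_iff_null_sets) auto
  then have "negligible (U \<inter> kelvin c R -` {M<..})"
    unfolding negligible_iff_null_sets by (rule null_sets_completionI)
  ultimately show False by blast
qed

text \<open>
  Strict inequality at a point persists for nearby radii, so almost every point eventually leaves the
  overshoot sets, and dominated convergence applies.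
\<close>

lemma emeasure_overshoot_tendsto_zero:
  assumes R: "0 < R" "overshoot c R = {}" and R0: "R0 < dist c z0" "R \<le> R0"
    and s: "\<And>n. 0 < s n" "\<And>n. s n \<le> R0" "s \<longlonglongrightarrow> R"
  shows "(\<lambda>n. emeasure lborel (overshoot c (s n))) \<longlonglongrightarrow> 0"
proof -
  have [measurable]: "ball c R0 \<in> sets borel" by simp
  have fin: "emeasure lborel (overshoot c (s n)) < \<infinity>" for n
  proof -
    have "emeasure lborel (overshoot c (s n)) \<le> emeasure lborel (ball c (s n))"
      by (rule emeasure_mono[OF overshoot_subset_ball]) simp
    also have "\<dots> < \<infinity>" using s(1)[of n] by (simp add: emeasure_ball)
    finally show ?thesis .
  qed
  have "(\<lambda>n. \<integral>y. indicator (overshoot c (s n)) y \<partial>lborel) \<longlonglongrightarrow> (\<integral>y. 0 \<partial>(lborel :: 'a measure) :: real)"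
  proof (rule integral_dominated_convergence[where w = "indicator (ball c R0)"])
    show "integrable lborel (indicator (ball c R0) :: 'a \<Rightarrow> real)"
      using R R0 by (simp add: emeasure_ball)
    show "AE y in lborel. norm (indicator (overshoot c (s n)) y :: real) \<le> indicator (ball c R0) y" for n
    proof -
      have "overshoot c (s n) \<subseteq> ball c R0" using overshoot_subset_ball[of c "s n"] s(2)[of n] by force
      then show ?thesis by (intro AE_I2) (auto simp: indicator_def subset_eq)
    qed
    have "sphere c R \<in> null_sets lborel"
      using negligible_sphere[of c R] by (simp add: negligible_iff_null_sets null_sets_completion_iff)
    then have "AE y in lborel. y \<notin> sphere c R" by (rule AE_not_in)
    then show "AE y in lborel. (\<lambda>n. indicator (overshoot c (s n)) y :: real) \<longlonglongrightarrow> 0"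
      using AE_neq[of c] AE_neq[of "inversion c R z0"]
    proof eventually_elim
      fix y assume y: "y \<notin> sphere c R" "y \<noteq> c" "y \<noteq> inversion c R z0"
      have "eventually (\<lambda>n. y \<notin> overshoot c (s n)) sequentially"
      proof (cases "R < dist c y")
        case True
        have "eventually (\<lambda>n. s n < dist c y) sequentially"
          using order_tendstoD(2)[OF s(3) True] .
        then show ?thesis by eventually_elim (auto simp: overshoot_def)
      next
        case False
        then have yb: "y \<in> ball c R - {c, inversion c R z0}" using y by auto
        have inv: "inversion c R y \<noteq> z0" using y R by (auto simp: inversion_eq_iff)
        have strict: "u y < kelvin c R y"
          by (rule overshoot_empty_imp_strict[OF R(1) _ R(2) yb]) (use R0 in simp)
        have "(\<lambda>n. kelvin c (s n) y) \<longlonglongrightarrow> kelvin c R y"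
          by (rule filterlim_compose[OF tendsto_kelvin_radius[OF y(2) inv R(1)] s(3)])
        then have "eventually (\<lambda>n. u y < kelvin c (s n) y) sequentially"
          using strict by (rule order_tendstoD(1))
        then show ?thesis by eventually_elim (auto simp: overshoot_def)
      qed
      then show "(\<lambda>n. indicator (overshoot c (s n)) y :: real) \<longlonglongrightarrow> 0"
        by (intro tendsto_eventually) (auto elim!: eventually_mono)
    qed
  qed auto
  then have "(\<lambda>n. measure lborel (overshoot c (s n))) \<longlonglongrightarrow> 0" by simp
  then have "(\<lambda>n. ennreal (measure lborel (overshoot c (s n)))) \<longlonglongrightarrow> ennreal 0" by (rule tendsto_ennrealI)
  moreover have "ennreal (measure lborel (overshoot c (s n))) = emeasure lborel (overshoot c (s n))" for n
    using fin[of n] by (simp add: emeasure_eq_ennreal_measure)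
  ultimately show ?thesis by simp
qed

lemma eventually_overshoot_empty:
  assumes R: "0 < R" "R < dist c z0" "overshoot c R = {}"
  shows "eventually (\<lambda>R'. overshoot c R' = {}) (nhds R)"
proof -
  define R0 where "R0 = (R + dist c z0) / 2"
  have R0: "R < R0" "R0 < dist c z0" using R by (auto simp: R0_def)
  obtain \<delta> where \<delta>: "\<delta> > 0"
    "\<And>R. 0 < R \<Longrightarrow> R \<le> R0 \<Longrightarrow> emeasure lborel (overshoot c R) \<le> ennreal \<delta> \<Longrightarrow> overshoot c R = {}"
    using small_overshoot_is_empty[OF R0(2)] by blast
  have "eventually (\<lambda>R'. overshoot c R' = {}) (at R within {0<..<R0})"
  proof (rule sequentially_imp_eventually_within, intro allI impI, elim conjE)
    fix s :: "nat \<Rightarrow> real" assume s: "\<forall>n. s n \<in> {0<..<R0} \<and> s n \<noteq> R" "s \<longlonglongrightarrow> R"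
    have s': "0 < s n" "s n \<le> R0" for n using s(1)[rule_format, of n] by auto
    have "(\<lambda>n. emeasure lborel (overshoot c (s n))) \<longlonglongrightarrow> 0"
      by (rule emeasure_overshoot_tendsto_zero[OF R(1,3) R0(2) less_imp_le[OF R0(1)] s' s(2)])
    then have "eventually (\<lambda>n. emeasure lborel (overshoot c (s n)) < ennreal \<delta>) sequentially"
      by (rule order_tendstoD(2)) (use \<delta> in simp)
    then show "eventually (\<lambda>n. overshoot c (s n) = {}) sequentially"
      by eventually_elim (use \<delta>(2) s' in \<open>simp add: less_imp_le\<close>)
  qed
  then have "eventually (\<lambda>R'. overshoot c R' = {}) (at R)"
    using R R0 by (simp add: at_within_open[of R "{0<..<R0}"])
  then show ?thesis using R(3) by (simp add: eventually_nhds_conv_at)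
qed

lemma eventually_overshoot_nonempty:
  assumes R: "0 < R" "overshoot c R \<noteq> {}"
  shows "eventually (\<lambda>R'. overshoot c R' \<noteq> {}) (nhds R)"
proof -
  obtain y where y: "y \<in> ball c R" "y \<noteq> c" "y \<noteq> inversion c R z0" "kelvin c R y < u y"
    using R(2) by (auto simp: overshoot_def)
  have inv: "inversion c R y \<noteq> z0" using y R by (auto simp: inversion_eq_iff)
  have "((\<lambda>R. inversion c R y) \<longlongrightarrow> inversion c R y) (nhds R)"
    unfolding inversion_def using y by (intro tendsto_intros filterlim_ident) auto
  then have "eventually (\<lambda>R'. inversion c R' y \<noteq> z0) (nhds R)"
    by (rule tendsto_imp_eventually_ne) (rule inv)
  moreover have "eventually (\<lambda>R'. kelvin c R' y < u y) (nhds R)"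
    by (rule order_tendstoD(2)[OF tendsto_kelvin_radius[OF y(2) inv R(1)] y(4)])
  moreover have "eventually (\<lambda>R'. R' > dist c y) (nhds R)"
    using y(1) by (intro order_tendstoD(1)[OF filterlim_ident]) simp
  moreover have "eventually (\<lambda>R'. R' > 0) (nhds R)"
    by (rule order_tendstoD(1)[OF filterlim_ident R(1)])
  ultimately show ?thesis
  proof eventually_elim
    fix R' assume "inversion c R' y \<noteq> z0" "kelvin c R' y < u y" "R' > dist c y" "R' > 0"
    then have "y \<in> overshoot c R'" using y(2) by (auto simp: overshoot_def inversion_eq_iff)
    then show "overshoot c R' \<noteq> {}" by blast
  qed
qed

text \<open>
  The radii with empty and with nonempty overshoot set form two disjoint open subsets of an interval,
  and the first one is inhabited.
\<close>

lemma overshoot_empty: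
  assumes R: "0 < R" "R < dist c z0"
  shows "overshoot c R = {}"
proof (rule ccontr)
  assume nonempty: "overshoot c R \<noteq> {}"
  have "c \<noteq> z0" using R by auto
  then obtain R1 where R1: "0 < R1" "R1 < dist c z0" "overshoot c R1 = {}"
    using overshoot_empty_for_small_radius by blast
  define I where "I = {0<..<dist c z0}"
  define U where "U = {r \<in> I. overshoot c r = {}}"
  define V where "V = {r \<in> I. overshoot c r \<noteq> {}}"
  have "open U"
  proof (subst open_subopen, intro ballI)
    fix r assume "r \<in> U"
    then have "eventually (\<lambda>r'. r' \<in> I \<and> overshoot c r' = {}) (nhds r)"
      by (intro eventually_conj eventually_overshoot_empty eventually_nhds_in_open) (auto simp: U_def I_def)
    then show "\<exists>T. open T \<and> r \<in> T \<and> T \<subseteq> U" by (auto simp: eventually_nhds U_def subset_eq)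
  qed
  moreover have "open V"
  proof (subst open_subopen, intro ballI)
    fix r assume "r \<in> V"
    then have "eventually (\<lambda>r'. r' \<in> I \<and> overshoot c r' \<noteq> {}) (nhds r)"
      by (intro eventually_conj eventually_overshoot_nonempty eventually_nhds_in_open) (auto simp: V_def I_def)
    then show "\<exists>T. open T \<and> r \<in> T \<and> T \<subseteq> V" by (auto simp: eventually_nhds V_def subset_eq)
  qed
  moreover have "connected I" by (simp add: I_def)
  ultimately have "U \<inter> I = {} \<or> V \<inter> I = {}"
    by (intro connectedD[of I U V]) (auto simp: U_def V_def)
  moreover have "R1 \<in> U \<inter> I" "R \<in> V \<inter> I"
    using R R1 nonempty by (auto simp: U_def V_def I_def)
  ultimately show False by blast
qed

section \<open>Radial symmetry\<close>

text \<open>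
  The point \<open>c = x + t *\<^sub>R e\<close> lies beyond \<open>x\<close> on the line from \<open>y\<close>. The square of the radius that
  exchanges \<open>x\<close> and \<open>y\<close> is \<open>t * (t + d)\<close>, while \<open>z0\<close> being equidistant from \<open>x\<close> and \<open>y\<close> gives
  \<open>(dist c z0)\<^sup>2 = (dist x z0)\<^sup>2 + t * (t + d)\<close>. So these spheres leave the singularity outside for
  every \<open>t > 0\<close>, and as \<open>t\<close> grows they approach the hyperplane that bisects \<open>x\<close> and \<open>y\<close>.
\<close>

lemma u_le_of_dist_eq:
  assumes x: "x \<noteq> z0" and y: "y \<noteq> z0" and dist: "dist x z0 = dist y z0"
  shows "u x \<le> u y"
proof (cases "x = y")
  case False
  define d where "d = norm (x - y)"
  have d: "d > 0" using False by (simp add: d_def)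
  define e where "e = (1 / d) *\<^sub>R (x - y)"
  have e: "norm e = 1" "y = x - d *\<^sub>R e" using d by (auto simp: e_def d_def)
  have inner: "(x - z0) \<bullet> e = d / 2"
  proof -
    have shift: "y - z0 = 1 *\<^sub>R (x - z0) - d *\<^sub>R e" using e(2) by simp
    have "(norm (y - z0))\<^sup>2 = (norm (x - z0))\<^sup>2 - 2 * d * ((x - z0) \<bullet> e) + d\<^sup>2"
      unfolding shift using norm_scaleR_diff_square[of 1 "x - z0" d e] e(1) by simp
    then have "d * (d - 2 * ((x - z0) \<bullet> e)) = 0"
      using dist by (simp add: dist_norm power2_eq_square algebra_simps)
    then show ?thesis using d by simp
  qed
  have bound: "u x \<le> sqrt (1 + d / t) powr (real DIM('a) - \<alpha>) * u y" if t: "t > 0" for t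
  proof -
    define c where "c = x + t *\<^sub>R e"
    define R where "R = sqrt (t * (t + d))"
    have R: "R > 0" "R\<^sup>2 = t * (t + d)" using t d by (auto simp: R_def)
    have xc: "x - c = - (t *\<^sub>R e)" "norm (x - c) = t" using t e(1) by (auto simp: c_def)
    have tR: "t < R" using t d unfolding R_def by (intro real_less_rsqrt) (simp add: power2_eq_square)
    have inv: "inversion c R x = y"
    proof -
      have *: "R\<^sup>2 / t\<^sup>2 * t = t + d" using t R(2) by (simp add: power2_eq_square)
      have "inversion c R x = c + (R\<^sup>2 / t\<^sup>2) *\<^sub>R (- (t *\<^sub>R e))"
        unfolding inversion_def xc(2) unfolding xc(1) by (rule refl)
      also have "\<dots> = c - (R\<^sup>2 / t\<^sup>2 * t) *\<^sub>R e" by simp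
      also have "\<dots> = c - (t + d) *\<^sub>R e" unfolding * by (rule refl)
      also have "\<dots> = y" by (simp add: c_def e(2) algebra_simps)
      finally show ?thesis .
    qed
    have "R < dist c z0"
    proof -
      have shift: "c - z0 = 1 *\<^sub>R (x - z0) - (- t) *\<^sub>R e" by (simp add: c_def)
      have "(norm (c - z0))\<^sup>2 = (norm (x - z0))\<^sup>2 + 2 * t * ((x - z0) \<bullet> e) + t\<^sup>2"
        unfolding shift using norm_scaleR_diff_square[of 1 "x - z0" "- t" e] e(1) by simp
      then have "(norm (c - z0))\<^sup>2 = (norm (x - z0))\<^sup>2 + R\<^sup>2"
        using R(2) inner by (simp add: power2_eq_square algebra_simps)
      then have "R\<^sup>2 < (norm (c - z0))\<^sup>2" using x by simp
      then have "R < norm (c - z0)" by (rule power2_less_imp_less) simp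
      then show ?thesis by (simp add: dist_norm)
    qed
    then have "x \<notin> overshoot c R" using overshoot_empty R(1) by simp
    moreover have "x \<in> ball c R" using xc(2) tR by (simp add: dist_norm norm_minus_commute)
    moreover have "x \<noteq> c" using xc t by auto
    moreover have "x \<noteq> inversion c R z0" using inv y R(1) by auto
    ultimately have "u x \<le> kelvin c R x" by (auto simp: overshoot_def)
    also have "\<dots> = (R / t) powr (real DIM('a) - \<alpha>) * u y" by (simp add: kelvin_def inv xc(2))
    also have "R / t = sqrt (1 + d / t)"
    proof -
      have "1 + d / t = t * (t + d) / t\<^sup>2" using t by (simp add: field_simps power2_eq_square)
      then show ?thesis using t by (simp add: R_def real_sqrt_divide)
    qed
    finally show ?thesis .
  qed
  have "((\<lambda>t. sqrt (1 + d / t) powr (real DIM('a) - \<alpha>) * u y) \<longlongrightarrow> sqrt (1 + 0) powr (real DIM('a) - \<alpha>) * u y) at_top"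
    by (intro tendsto_intros tendsto_divide_0[OF tendsto_const] filterlim_at_top_imp_at_infinity filterlim_ident) auto
  then have "((\<lambda>t. sqrt (1 + d / t) powr (real DIM('a) - \<alpha>) * u y) \<longlongrightarrow> u y) at_top" by simp
  moreover have "eventually (\<lambda>t. u x \<le> sqrt (1 + d / t) powr (real DIM('a) - \<alpha>) * u y) at_top"
    using eventually_gt_at_top[of 0] by (rule eventually_mono) (rule bound)
  ultimately show ?thesis
    by (rule tendsto_lowerbound) simp
qed simp

end

lemma riesz_integrand_eq:
  fixes u :: "real^'n \<Rightarrow> real"
  shows "riesz_integrand \<alpha> p u x y = riesz_kernel \<alpha> (x - y) * u y powr p"
  using powr_minus_divide[of "norm (x - y)" "real CARD('n) - \<alpha>"]
  by (simp add: riesz_integrand_def riesz_kernel_def)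

lemma only_singularity_nonsingular:
  assumes "only_singularity u z" "x \<noteq> z"
  shows "\<not> is_singularity (u :: 'a::t1_space \<Rightarrow> real) x"
proof
  assume sing: "is_singularity u x"
  obtain U where U: "open U" "x \<in> U" "bounded (u ` (U \<inter> - {z}))"
    using assms unfolding only_singularity_def locally_bounded_on_def by blast
  have "open (U - {z})" "x \<in> U - {z}" using U assms(2) by auto
  then have "\<not> bounded (u ` (U - {z} - {x}))"
    using sing unfolding is_singularity_def by blast
  moreover have "u ` (U - {z} - {x}) \<subseteq> u ` (U \<inter> - {z})" by auto
  ultimately show False using U(3) bounded_subset by blast
qed

text \<open>
  Off \<open>x0\<close> the equation expresses \<open>u\<close> as an integral depending on a parameter. Its integrand may be
  replaced by a Borel function without changing the integral, so \<open>u\<close> is Borel measurable.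
\<close>

lemma positive_solution_singular_riesz_solution:
  fixes u :: "real^'n \<Rightarrow> real"
  assumes \<alpha>: "0 < \<alpha>" "\<alpha> < real CARD('n)"
    and p: "p \<le> (real CARD('n) + \<alpha>) / (real CARD('n) - \<alpha>)"
    and sol: "positive_solution \<alpha> p u" and sing: "only_singularity u x0"
  shows "singular_riesz_solution \<alpha> p u x0"
proof -
  have u_leb: "u \<in> borel_measurable (completion lborel)" using sol by (simp add: positive_solution_def)
  have nonsing: "0 < u x" "integrable lebesgue (\<lambda>y. riesz_kernel \<alpha> (x - y) * u y powr p)"
      "u x = (\<integral>y. riesz_kernel \<alpha> (x - y) * u y powr p \<partial>lebesgue)" if "x \<noteq> x0" for x
    using sol only_singularity_nonsingular[OF sing that]
    unfolding positive_solution_def riesz_integrand_eq[abs_def] by auto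
  obtain g where g [measurable]: "g \<in> borel_measurable lborel" and ug: "AE y in lborel. u y = g y"
    using completion_ex_borel_measurable_real[OF u_leb] by blast
  define v where "v x = (\<integral>y. riesz_kernel \<alpha> (x - y) * g y powr p \<partial>lborel)" for x
  have v_meas [measurable]: "v \<in> borel_measurable borel"
  proof -
    have [measurable]: "g \<in> borel_measurable borel" using g by simp
    have "v \<in> borel_measurable lborel"
      unfolding v_def by (rule lborel.borel_measurable_lebesgue_integral) measurable
    then show ?thesis by simp
  qed
  have uv: "u x = v x" if x: "x \<noteq> x0" for x
  proof -
    have [measurable]: "g \<in> borel_measurable borel" using g by simp
    have "u x = (\<integral>y. riesz_kernel \<alpha> (x - y) * u y powr p \<partial>lebesgue)" by (rule nonsing(3)[OF x])
    also have "\<dots> = (\<integral>y. riesz_kernel \<alpha> (x - y) * g y powr p \<partial>lebesgue)"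
    proof (rule integral_cong_AE)
      show "(\<lambda>y. riesz_kernel \<alpha> (x - y) * u y powr p) \<in> borel_measurable lebesgue"
        using nonsing(2)[OF x] by (rule borel_measurable_integrable)
      show "(\<lambda>y. riesz_kernel \<alpha> (x - y) * g y powr p) \<in> borel_measurable lebesgue"
        by (rule measurable_completion) measurable
      show "AE y in lebesgue. riesz_kernel \<alpha> (x - y) * u y powr p = riesz_kernel \<alpha> (x - y) * g y powr p"
        by (rule AE_completion) (use ug in eventually_elim, simp)
    qed
    also have "\<dots> = v x"
      unfolding v_def by (rule integral_completion) measurable
    finally show ?thesis .
  qed
  have "u = (\<lambda>x. if x = x0 then u x0 else v x)" using uv by auto
  also have "\<dots> \<in> borel_measurable borel" by measurable
  finally have [measurable]: "u \<in> borel_measurable borel" .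
  show ?thesis
  proof
    show "0 < \<alpha>" "\<alpha> < real DIM(real^'n)" "p \<le> (real DIM(real^'n) + \<alpha>) / (real DIM(real^'n) - \<alpha>)"
      using \<alpha> p by simp_all
    show "u \<in> borel_measurable borel" by measurable
    show "0 < u x" if "x \<noteq> x0" for x using nonsing(1)[OF that] .
    show "ennreal (u x) = (\<integral>\<^sup>+y. ennreal (riesz_kernel \<alpha> (x - y)) * ennreal (u y powr p) \<partial>lborel)"
      if x: "x \<noteq> x0" for x
    proof -
      have meas: "(\<lambda>y. riesz_kernel \<alpha> (x - y) * u y powr p) \<in> borel_measurable lborel" by measurable
      have int: "integrable lborel (\<lambda>y. riesz_kernel \<alpha> (x - y) * u y powr p)"
        using nonsing(2)[OF x] integrable_completion[OF meas] by simp
      have "(\<integral>\<^sup>+y. ennreal (riesz_kernel \<alpha> (x - y) * u y powr p) \<partial>lborel) = ennreal (u x)"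
        using nn_integral_eq_integral[OF int] nonsing(3)[OF x] integral_completion[OF meas] by simp
      then show ?thesis by (simp add: ennreal_mult)
    qed
    show "\<exists>r>0. \<exists>M. \<forall>y\<in>ball x r - {x0}. u y \<le> M" if x: "x \<noteq> x0" for x
    proof -
      obtain U where U: "open U" "x \<in> U" "bounded (u ` (U \<inter> - {x0}))"
        using sing x unfolding only_singularity_def locally_bounded_on_def by blast
      then obtain r where r: "r > 0" "ball x r \<subseteq> U" by (meson openE)
      obtain M where "\<forall>v\<in>u ` (U \<inter> - {x0}). norm v \<le> M" using U(3) unfolding bounded_iff by blast
      then have "\<forall>y\<in>ball x r - {x0}. norm (u y) \<le> M" using r(2) by blast
      then have "\<forall>y\<in>ball x r - {x0}. u y \<le> M" by force
      with r(1) show ?thesis by blast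
    qed
    show "\<exists>y\<in>ball x0 r - {x0}. M < u y" if r: "r > 0" for r M
    proof (rule ccontr)
      assume "\<not> ?thesis"
      then have le: "u y \<le> M" if "y \<in> ball x0 r - {x0}" for y
        using that not_le by blast
      have "norm (u y) \<le> M" if "y \<in> ball x0 r - {x0}" for y
        using le[OF that] nonsing(1)[of y] that by simp
      then have "bounded (u ` (ball x0 r - {x0}))" unfolding bounded_iff by blast
      moreover have "open (ball x0 r)" "x0 \<in> ball x0 r" using r by auto
      ultimately show False
        using sing unfolding only_singularity_def is_singularity_def by blast
    qed
  qed
qed

theorem theorem2:
  fixes \<alpha> p :: real
    and u :: "real^'n \<Rightarrow> real"
    and x0 :: "real^'n"
  assumes "0 < \<alpha>" and "\<alpha> < real CARD('n)"
    and "p \<le> (real CARD('n) + \<alpha>) / (real CARD('n) - \<alpha>)"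
    and "positive_solution \<alpha> p u"
    and "only_singularity u x0"
  shows "\<forall>x y. x \<noteq> x0 \<longrightarrow> y \<noteq> x0 \<longrightarrow> norm (x - x0) = norm (y - x0) \<longrightarrow> u x = u y"
proof (intro allI impI)
  interpret singular_riesz_solution \<alpha> p u x0
    by (rule positive_solution_singular_riesz_solution) fact+
  fix x y assume "x \<noteq> x0" "y \<noteq> x0" "norm (x - x0) = norm (y - x0)"
  then show "u x = u y"
    by (intro antisym u_le_of_dist_eq) (simp_all add: dist_norm)
qed

end
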